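(* Let $\mathcal{S}$ be the set of step skew products $F\colon\Sigma_4\times[0,1]\to\Sigma_4\times[0,1]$, $F(\vartheta,x)=(\sigma(\vartheta),f_{\vartheta_0}(x))$, with $C^1$ fiber maps $f_1,\dots,f_4\colon[0,1]\to[0,1]$, endowed with the metric $d(F,G)=\max_i d_{C^1}(f_i,g_i)$, where $f_i$ and $g_i$ are the fiber maps of $F$ and $G$. For every $m\ge1$ there is a nonempty open set $\mathcal{S}_m\subset\mathcal{S}$ of step skew products with injective fiber maps such that every $F\in\mathcal{S}_m$ has the following properties: (1) For every disjunctive point $z$ one has $\overline{\mathrm{graph}\,\rho}=\omega_F(z)$. (2) There is a dense subset $\Gamma$ of $\Sigma_4$ such that for every sequence $\vartheta\in\Gamma$ the intersection of the fibre $\{\vartheta\}\times[0,1]$ with $\overline{\mathrm{graph}\,\rho}$ is the union of $m$ disjoint nontrivial intervals.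
   Context: $\Sigma_4=\{1,2,3,4\}^{\mathbb{Z}}$ carries the product topology, $\sigma$ is the (left) shift map, and $d_{C^1}$ is the $C^1$ uniform distance. For a step skew product $F$ with fiber maps $f_i\colon[0,1]\to[0,1]$, the set of weakly hyperbolic sequences is $S_F=\{\vartheta\in\Sigma_4:\ \bigcap_{n\ge0}f_{\vartheta_{-1}}\circ\cdots\circ f_{\vartheta_{-n}}([0,1])\text{ is a singleton}\}$. The coding map is $\rho\colon S_F\to[0,1]$, $\rho(\vartheta)=\lim_{n\to\infty}f_{\vartheta_{-1}}\circ\cdots\circ f_{\vartheta_{-n}}(p)$ (independent of $p$), and $\mathrm{graph}\,\rho=\{(\vartheta,\rho(\vartheta)):\vartheta\in S_F\}$. A sequence $\vartheta$ is disjunctive if its forward $\sigma$-orbit is dense in $\Sigma_4$, and a point $z=(\vartheta,x)$ is disjunctive if $\vartheta$ is. $\omega_F(z)$ is the set of limits of sequences $F^{n_j}(z)$ with $n_j\to\infty$. A nontrivial interval is one not reduced to a point. *)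

theory Defs
  imports "HOL-Analysis.Analysis"
begin

text \<open>
  Sequences over the alphabet \<open>{1, 2, 3, 4}\<close> are functions \<^typ>\<open>int \<Rightarrow> nat\<close>. As \<^typ>\<open>nat\<close> is
  discrete, the library topology on \<^typ>\<open>int \<Rightarrow> nat\<close> induces on \<open>\<Sigma>4\<close> the product topology.
  Since \<open>\<Sigma>4 \<times> {0..1}\<close> is closed (\<open>closed_\<Sigma>4\<close> below), closures and limits
  of its subsets may be taken in the ambient type.
\<close>

definition \<Sigma>4 :: "(int \<Rightarrow> nat) set" where
  "\<Sigma>4 = {\<theta>. \<forall>k. \<theta> k \<in> {1..4}}"

definition shift :: "(int \<Rightarrow> nat) \<Rightarrow> int \<Rightarrow> nat" where
  "shift \<theta> = (\<lambda>k. \<theta> (k + 1))"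

text \<open>
  Maps on \<open>{0..1}\<close> and on \<open>\<Sigma>4 \<times> {0..1}\<close> are extensional, i.e. equal to \<^const>\<open>undefined\<close>
  outside their domain, so that equality of the HOL functions is equality of maps.
  Derivatives at 0 and 1 are one-sided. The library predicate for \<open>C\<^sup>1\<close> functions uses
  two-sided derivatives and is not applicable here.
\<close>

definition deriv01 :: "(real \<Rightarrow> real) \<Rightarrow> real \<Rightarrow> real" where
  "deriv01 f x = vector_derivative f (at x within {0..1})"

definition C1_maps :: "(real \<Rightarrow> real) set" where
  "C1_maps = {f \<in> {0..1} \<rightarrow>\<^sub>E {0..1}.
     f differentiable_on {0..1} \<and> continuous_on {0..1} (deriv01 f)}"

definition dist_C1 :: "(real \<Rightarrow> real) \<Rightarrow> (real \<Rightarrow> real) \<Rightarrow> real" where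
  "dist_C1 f g = max (SUP x\<in>{0..1}. \<bar>f x - g x\<bar>) (SUP x\<in>{0..1}. \<bar>deriv01 f x - deriv01 g x\<bar>)"

type_synonym skew_map = "(int \<Rightarrow> nat) \<times> real \<Rightarrow> (int \<Rightarrow> nat) \<times> real"

definition step_skew :: "(nat \<Rightarrow> real \<Rightarrow> real) \<Rightarrow> skew_map" where
  "step_skew f = (\<lambda>(\<theta>, x)\<in>\<Sigma>4 \<times> {0..1}. (shift \<theta>, f (\<theta> 0) x))"

definition step_skew_products :: "skew_map set" where
  "step_skew_products = step_skew ` ({1..4} \<rightarrow>\<^sub>E C1_maps)"

text \<open>
  The fibre maps are recovered from the skew product by means of the constant sequences,
  see \<open>fiber_map_step_skew\<close> below.
\<close>

definition fiber_map :: "skew_map \<Rightarrow> nat \<Rightarrow> real \<Rightarrow> real" where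
  "fiber_map F i = (\<lambda>x\<in>{0..1}. snd (F ((\<lambda>_. i), x)))"

text \<open>
  The locale \<^locale>\<open>Metric_space\<close> requires the distance to be nonnegative on the whole type,
  hence the value 0 outside \<open>step_skew_products\<close>.
\<close>

definition dist_skew :: "skew_map \<Rightarrow> skew_map \<Rightarrow> real" where
  "dist_skew F G =
     (if F \<in> step_skew_products \<and> G \<in> step_skew_products
      then MAX i\<in>{1..4}. dist_C1 (fiber_map F i) (fiber_map G i) else 0)"

abbreviation skew_topology :: "skew_map topology" where
  "skew_topology \<equiv> Metric_space.mtopology step_skew_products dist_skew"

text \<open>\<open>backward_comp F \<theta> n\<close> is \<open>f\<^bsub>\<theta>(-1)\<^esub> \<circ> \<dots> \<circ> f\<^bsub>\<theta>(-n)\<^esub>\<close>, the identity if \<open>n = 0\<close>.\<close>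

primrec backward_comp :: "skew_map \<Rightarrow> (int \<Rightarrow> nat) \<Rightarrow> nat \<Rightarrow> real \<Rightarrow> real" where
  "backward_comp F \<theta> 0 = id"
| "backward_comp F \<theta> (Suc n) = backward_comp F \<theta> n \<circ> fiber_map F (\<theta> (- int (Suc n)))"

definition weakly_hyperbolic :: "skew_map \<Rightarrow> (int \<Rightarrow> nat) set" where
  "weakly_hyperbolic F = {\<theta> \<in> \<Sigma>4. is_singleton (\<Inter>n. backward_comp F \<theta> n ` {0..1})}"

definition coding_map :: "skew_map \<Rightarrow> (int \<Rightarrow> nat) \<Rightarrow> real" where
  "coding_map F \<theta> = (THE y. \<forall>p\<in>{0..1}. (\<lambda>n. backward_comp F \<theta> n p) \<longlonglongrightarrow> y)"

definition coding_graph :: "skew_map \<Rightarrow> ((int \<Rightarrow> nat) \<times> real) set" where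
  "coding_graph F = (\<lambda>\<theta>. (\<theta>, coding_map F \<theta>)) ` weakly_hyperbolic F"

definition dense_in_\<Sigma>4 :: "(int \<Rightarrow> nat) set \<Rightarrow> bool" where
  "dense_in_\<Sigma>4 A \<longleftrightarrow> A \<subseteq> \<Sigma>4 \<and> \<Sigma>4 \<subseteq> closure A"

definition disjunctive :: "(int \<Rightarrow> nat) \<Rightarrow> bool" where
  "disjunctive \<theta> \<longleftrightarrow> \<theta> \<in> \<Sigma>4 \<and> dense_in_\<Sigma>4 (range (\<lambda>n. (shift ^^ n) \<theta>))"

definition omega_limit :: "('a::topological_space \<Rightarrow> 'a) \<Rightarrow> 'a \<Rightarrow> 'a set" where
  "omega_limit F z = {y. \<exists>r::nat \<Rightarrow> nat. filterlim r at_top sequentially \<and>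
                           (\<lambda>j. (F ^^ r j) z) \<longlonglongrightarrow> y}"

text \<open>
  The intervals are required to be compact. If half-open intervals were admitted, a single
  nontrivial interval would be a disjoint union of any number \<open>m \<ge> 1\<close> of nontrivial intervals,
  and the number \<open>m\<close> would carry no information.
\<close>

definition union_of_intervals :: "nat \<Rightarrow> real set \<Rightarrow> bool" where
  "union_of_intervals m A \<longleftrightarrow> (\<exists>\<I>. finite \<I> \<and> card \<I> = m \<and> disjoint \<I> \<and>
     (\<forall>I\<in>\<I>. \<exists>a b. a < b \<and> I = {a..b}) \<and> A = \<Union>\<I>)"

lemma closed_\<Sigma>4: "closed \<Sigma>4"
proof -
  have eq: "\<Sigma>4 = (\<Inter>k. (\<lambda>\<theta>. \<theta> k) -` {1..4})"
    by (auto simp: \<Sigma>4_def)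
  show ?thesis
    unfolding eq
    by (intro closed_INT ballI closed_vimage continuous_on_product_coordinates closed_atLeastAtMost)
qed

lemma fiber_map_step_skew:
  assumes "f \<in> {1..4} \<rightarrow>\<^sub>E C1_maps" and i: "i \<in> {1..4}"
  shows "fiber_map (step_skew f) i = f i"
proof -
  have "f i \<in> {0..1} \<rightarrow>\<^sub>E {0..1}"
    using assms by (auto simp: C1_maps_def)
  then show ?thesis
    using i by (auto simp: fiber_map_def step_skew_def \<Sigma>4_def fun_eq_iff restrict_def
        PiE_def extensional_def)
qed

lemma fiber_map_in_C1_maps:
  assumes "F \<in> step_skew_products" "i \<in> {1..4}"
  shows "fiber_map F i \<in> C1_maps"
proof -
  obtain f where f: "f \<in> {1..4} \<rightarrow>\<^sub>E C1_maps" "F = step_skew f"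
    using assms(1) by (auto simp: step_skew_products_def)
  show ?thesis
    using PiE_mem[OF f(1) assms(2)] fiber_map_step_skew[OF f(1) assms(2)] f(2) by simp
qed

lemma sup_abs_diff:
  fixes f g h :: "real \<Rightarrow> real"
  assumes "continuous_on {0..1} f" "continuous_on {0..1} g" "continuous_on {0..1} h"
  shows "x \<in> {0..1} \<Longrightarrow> \<bar>f x - g x\<bar> \<le> (SUP x\<in>{0..1}. \<bar>f x - g x\<bar>)"
    and "0 \<le> (SUP x\<in>{0..1}. \<bar>f x - g x\<bar>)"
    and "(SUP x\<in>{0..1}. \<bar>f x - h x\<bar>) \<le> (SUP x\<in>{0..1}. \<bar>f x - g x\<bar>) + (SUP x\<in>{0..1}. \<bar>g x - h x\<bar>)"
proof -
  have bdd: "bdd_above ((\<lambda>x. \<bar>u x - v x\<bar>) ` {0..1})"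
    if "continuous_on {0..1} u" "continuous_on {0..1} v" for u v :: "real \<Rightarrow> real"
    by (intro bounded_imp_bdd_above compact_imp_bounded compact_continuous_image
        continuous_intros that compact_Icc)
  have up: "\<bar>u x - v x\<bar> \<le> (SUP x\<in>{0..1}. \<bar>u x - v x\<bar>)"
    if "continuous_on {0..1} u" "continuous_on {0..1} v" "x \<in> {0..1}"
    for u v :: "real \<Rightarrow> real" and x
    by (rule cSUP_upper[OF that(3) bdd[OF that(1,2)]])
  show "x \<in> {0..1} \<Longrightarrow> \<bar>f x - g x\<bar> \<le> (SUP x\<in>{0..1}. \<bar>f x - g x\<bar>)"
    by (rule up[OF assms(1,2)])
  have "0 \<le> \<bar>f 0 - g 0\<bar>" by simp
  also have "\<dots> \<le> (SUP x\<in>{0..1}. \<bar>f x - g x\<bar>)"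
    by (rule up[OF assms(1,2)]) simp
  finally show "0 \<le> (SUP x\<in>{0..1}. \<bar>f x - g x\<bar>)" .
  show "(SUP x\<in>{0..1}. \<bar>f x - h x\<bar>) \<le> (SUP x\<in>{0..1}. \<bar>f x - g x\<bar>) + (SUP x\<in>{0..1}. \<bar>g x - h x\<bar>)"
  proof (rule cSUP_least)
    fix x :: real assume x: "x \<in> {0..1}"
    have "\<bar>f x - h x\<bar> \<le> \<bar>f x - g x\<bar> + \<bar>g x - h x\<bar>" by simp
    with up[OF assms(1,2) x] up[OF assms(2,3) x]
    show "\<bar>f x - h x\<bar> \<le> (SUP x\<in>{0..1}. \<bar>f x - g x\<bar>) + (SUP x\<in>{0..1}. \<bar>g x - h x\<bar>)"
      by linarith
  qed simp
qed

lemma dist_C1: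
  assumes "f \<in> C1_maps" "g \<in> C1_maps" "h \<in> C1_maps"
  shows "x \<in> {0..1} \<Longrightarrow> \<bar>f x - g x\<bar> \<le> dist_C1 f g"
    and "0 \<le> dist_C1 f g"
    and "dist_C1 f h \<le> dist_C1 f g + dist_C1 g h"
proof -
  have c: "continuous_on {0..1} u" "continuous_on {0..1} (deriv01 u)" if "u \<in> C1_maps" for u
    using that by (auto simp: C1_maps_def intro: differentiable_imp_continuous_on)
  note a = sup_abs_diff[OF c(1)[OF assms(1)] c(1)[OF assms(2)] c(1)[OF assms(3)]]
  note b = sup_abs_diff[OF c(2)[OF assms(1)] c(2)[OF assms(2)] c(2)[OF assms(3)]]
  show "x \<in> {0..1} \<Longrightarrow> \<bar>f x - g x\<bar> \<le> dist_C1 f g"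
    using a(1) unfolding dist_C1_def by fastforce
  show "0 \<le> dist_C1 f g"
    using a(2) unfolding dist_C1_def by linarith
  show "dist_C1 f h \<le> dist_C1 f g + dist_C1 g h"
    using a(3) b(3) unfolding dist_C1_def by linarith
qed

lemma Metric_space_skew: "Metric_space step_skew_products dist_skew"
proof
  have comm: "dist_C1 f g = dist_C1 g f" for f g
    by (simp add: dist_C1_def abs_minus_commute)
  have ge: "dist_C1 (fiber_map F i) (fiber_map G i) \<le> dist_skew F G" if "i \<in> {1..4}" "F \<in> step_skew_products" "G \<in> step_skew_products" for F G i
    unfolding dist_skew_def using that by (auto intro!: Max_ge)
  show "0 \<le> dist_skew F G" for F G
  proof (cases "F \<in> step_skew_products \<and> G \<in> step_skew_products")
    case True
    then have "0 \<le> dist_C1 (fiber_map F 1) (fiber_map G 1)"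
      by (intro dist_C1(2)[OF _ _ fiber_map_in_C1_maps[of F 1]] fiber_map_in_C1_maps) auto
    also have "\<dots> \<le> dist_skew F G"
      using True by (intro ge) auto
    finally show ?thesis .
  qed (auto simp: dist_skew_def)
  show "dist_skew F G = dist_skew G F" for F G
    by (auto simp: dist_skew_def comm)
  show "dist_skew F G = 0 \<longleftrightarrow> F = G"
    if F: "F \<in> step_skew_products" and G: "G \<in> step_skew_products" for F G
  proof
    assume 0: "dist_skew F G = 0"
    obtain f g where f: "f \<in> {1..4} \<rightarrow>\<^sub>E C1_maps" "F = step_skew f"
      and g: "g \<in> {1..4} \<rightarrow>\<^sub>E C1_maps" "G = step_skew g"
      using F G by (auto simp: step_skew_products_def)
    have "f i x = g i x" if i: "i \<in> {1..4}" and x: "x \<in> {0..1}" for i x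
    proof -
      have "f i \<in> C1_maps" "g i \<in> C1_maps" using f g i by auto
      from dist_C1(1)[OF this this(2) x] ge[OF i F G] 0 show ?thesis
        using fiber_map_step_skew[OF f(1) i] fiber_map_step_skew[OF g(1) i] f(2) g(2) by simp
    qed
    then show "F = G"
      unfolding f(2) g(2) step_skew_def by (intro restrict_ext) (auto simp: \<Sigma>4_def)
  next
    assume "F = G"
    then show "dist_skew F G = 0" by (simp add: dist_skew_def dist_C1_def)
  qed
  show "dist_skew F H \<le> dist_skew F G + dist_skew G H"
    if F: "F \<in> step_skew_products" and G: "G \<in> step_skew_products"
      and H: "H \<in> step_skew_products" for F G H
  proof -
    have "dist_C1 (fiber_map F i) (fiber_map H i) \<le> dist_skew F G + dist_skew G H"
      if i: "i \<in> {1..4}" for i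
      using dist_C1(3)[OF fiber_map_in_C1_maps[OF F i] fiber_map_in_C1_maps[OF G i]
          fiber_map_in_C1_maps[OF H i]] ge[OF i F G] ge[OF i G H] by linarith
    then show ?thesis
      using F H by (simp add: dist_skew_def[of F H])
  qed
qed

end

theory Submission
  imports Defs
begin

text \<open>
  For a step skew product with injective fibre maps let \<open>K\<close> be the closure of the set of values of
  the coding map. Weak hyperbolicity only depends on the remote past, and changing the recent past
  applies a composition of fibre maps to the value of the coding map. Therefore \<open>K\<close> is forward
  invariant under the fibre maps, and the fibre of the closure of the graph over \<open>\<theta>\<close> is the
  decreasing intersection of the images of \<open>K\<close> under the compositions along the past of \<open>\<theta>\<close>
  (\<open>closure_coding_graph_iff\<close>). If moreover one fibre map sends the whole of \<open>{0..1}\<close> into \<open>K\<close>, the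
  limit set of every disjunctive point is the closure of the graph
  (\<open>omega_limit_disjunctive\<close>): every orbit ends up over \<open>K\<close>, and every finite piece of a weakly
  hyperbolic past is read infinitely often.

  It remains to find an open set of systems for which \<open>K\<close> is a union of \<open>m\<close> disjoint compact
  intervals, called blocks, each of which the first fibre map sends onto itself. Then the fibre
  over any sequence whose symbols in the remote past all equal 1 is an injective continuous image
  of \<open>K\<close>, hence again a union of \<open>m\<close> intervals, and these sequences are dense.

  Such systems are obtained as follows. The first fibre map pushes the points of each block away from
  a core inside the block towards the two end points, which are fixed. The second and third ones are
  contractions into the first block, and their images of the first core cover this core, so \<open>K\<close>
  contains the first core. Iterating the first fibre map spreads the core over its block. The fourth
  fibre map sends each block into the next one such that the image of a core covers the next
  core; this transports the containment in \<open>K\<close> from block to block. Conversely, the union of the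
  blocks is invariant and closed, so it contains \<open>K\<close> (\<open>attractor_eq_blocks\<close>). The
  blocks vary with the system, but they are controlled by inequalities at points and on
  compact intervals that do not depend on the system (locale \<open>block_system\<close>), so it suffices to exhibit one system
  satisfying these with some slack (\<open>exists_robust_block_system\<close>).
\<close>

section \<open>Windows, disjunctive sequences and limit sets\<close>

definition agree_on_window :: "nat \<Rightarrow> (int \<Rightarrow> nat) \<Rightarrow> (int \<Rightarrow> nat) \<Rightarrow> bool" where
  "agree_on_window N \<theta> \<theta>' \<longleftrightarrow> (\<forall>k\<in>{- int N..int N}. \<theta>' k = \<theta> k)"

lemma open_window: "open {\<theta>'. agree_on_window N \<theta> \<theta>'}"
  using product_topology_basis'[of "{- int N..int N}" "\<lambda>k. {\<theta> k}" "\<lambda>k. k"]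
  by (simp add: agree_on_window_def open_discrete)

lemma open_contains_window:
  assumes "open U" "\<theta> \<in> U"
  obtains N where "\<And>\<theta>'. agree_on_window N \<theta> \<theta>' \<Longrightarrow> \<theta>' \<in> U"
proof -
  obtain X where X: "\<theta> \<in> Pi\<^sub>E UNIV X" "finite {i. X i \<noteq> UNIV}" "Pi\<^sub>E UNIV X \<subseteq> U"
    using product_topology_open_contains_basis[of "\<lambda>_. euclidean" UNIV U \<theta>] assms
    by (auto simp: open_fun_def)
  obtain N where N: "\<And>i. X i \<noteq> UNIV \<Longrightarrow> nat \<bar>i\<bar> \<le> N"
    using X(2) finite_nat_set_iff_bounded_le[of "(\<lambda>i. nat \<bar>i\<bar>) ` {i. X i \<noteq> UNIV}"] by auto
  have "\<theta>' \<in> U" if a: "agree_on_window N \<theta> \<theta>'" for \<theta>'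
  proof -
    have "\<theta>' i \<in> X i" for i
    proof (cases "X i = UNIV")
      case False
      then have "\<theta>' i = \<theta> i" using N[OF False] a unfolding agree_on_window_def by (simp add: abs_le_iff nat_le_iff)
      moreover have "\<theta> i \<in> X i" using X(1) by auto
      ultimately show ?thesis by simp
    qed auto
    then show ?thesis using X(3) by auto
  qed
  then show ?thesis using that by blast
qed

lemma open_Times_contains_window:
  fixes U :: "((int \<Rightarrow> nat) \<times> real) set"
  assumes "open U" "(\<theta>, y) \<in> U"
  obtains N e where "e > 0"
    "\<And>\<theta>' y'. agree_on_window N \<theta> \<theta>' \<Longrightarrow> \<bar>y' - y\<bar> < e \<Longrightarrow> (\<theta>', y') \<in> U"
proof -
  obtain V W where VW: "open V" "open W" "\<theta> \<in> V" "y \<in> W" "V \<times> W \<subseteq> U"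
    using assms by (metis open_prod_elim mem_Sigma_iff)
  obtain N where "\<And>\<theta>'. agree_on_window N \<theta> \<theta>' \<Longrightarrow> \<theta>' \<in> V"
    using open_contains_window VW by metis
  moreover obtain e where "e > 0" "ball y e \<subseteq> W"
    using VW by (meson openE)
  ultimately show ?thesis
    using VW(5) that[of e N] by (auto simp: subset_iff dist_real_def abs_minus_commute)
qed

lemma infinite_window:
  assumes "\<theta> \<in> \<Sigma>4"
  shows "infinite {\<theta>' \<in> \<Sigma>4. agree_on_window N \<theta> \<theta>'}"
proof -
  define h where "h j = (\<lambda>k. if k \<le> int N then \<theta> k else if k = int N + int j + 1 then 1 else (2::nat))" for j :: nat
  have "inj h"
  proof (rule injI)
    fix i j assume "h i = h j"
    then have "h i (int N + int i + 1) = h j (int N + int i + 1)" by simp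
    then show "i = j" by (auto simp: h_def split: if_splits)
  qed
  then have "infinite (range h)" using finite_imageD by blast
  moreover have "range h \<subseteq> {\<theta>' \<in> \<Sigma>4. agree_on_window N \<theta> \<theta>'}"
    using assms by (auto simp: h_def \<Sigma>4_def agree_on_window_def)
  ultimately show ?thesis using finite_subset by blast
qed

lemma shift_funpow: "(shift ^^ n) \<theta> = (\<lambda>k. \<theta> (k + int n))"
  by (induction n) (auto simp: shift_def fun_eq_iff algebra_simps)

lemma shift_funpow_in_\<Sigma>4: "\<theta> \<in> \<Sigma>4 \<Longrightarrow> (shift ^^ n) \<theta> \<in> \<Sigma>4"
  by (simp add: shift_funpow \<Sigma>4_def)

text \<open>
  A dense orbit may not visit a window only finitely often: the window contains infinitely many
  sequences, and these would all lie in the closure of a finite set.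
\<close>

lemma disjunctive_infinitely_often:
  assumes "disjunctive \<theta>" "\<tau> \<in> \<Sigma>4"
  shows "\<exists>n\<ge>n0. agree_on_window N \<tau> ((shift ^^ n) \<theta>)"
proof (rule ccontr)
  assume neg: "\<not> ?thesis"
  let ?W = "{\<theta>'. agree_on_window N \<tau> \<theta>'}" and ?O = "range (\<lambda>n. (shift ^^ n) \<theta>)"
  have "?W \<inter> ?O \<subseteq> (\<lambda>n. (shift ^^ n) \<theta>) ` {..<n0}"
    using neg by (force simp: not_le)
  then have fin: "finite (?W \<inter> ?O)" by (meson finite_imageI finite_lessThan finite_subset)
  have "?W \<inter> \<Sigma>4 \<subseteq> ?W \<inter> closure ?O"
    using assms by (auto simp: disjunctive_def dense_in_\<Sigma>4_def)
  also have "\<dots> \<subseteq> closure (?W \<inter> ?O)"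
    by (rule open_Int_closure_subset[OF open_window])
  also have "\<dots> = ?W \<inter> ?O" proof (rule closure_closed)
    have cl: "closed {\<theta>'}" for \<theta>' :: "int \<Rightarrow> nat"
    proof -
      have "{\<theta>'} = (\<Inter>k. (\<lambda>\<tau>'. \<tau>' k) -` {\<theta>' k})" by auto
      also have "closed \<dots>"
        by (intro closed_INT ballI closed_vimage continuous_on_product_coordinates closed_singleton)
      finally show ?thesis .
    qed
    then have "closed (\<Union>\<theta>'\<in>?W \<inter> ?O. {\<theta>'})" by (intro closed_UN[OF fin] ballI cl)
    then show "closed (?W \<inter> ?O)" by simp
  qed
  finally have "finite (?W \<inter> \<Sigma>4)" using fin finite_subset by blast
  moreover have "?W \<inter> \<Sigma>4 = {\<theta>' \<in> \<Sigma>4. agree_on_window N \<tau> \<theta>'}" by auto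
  ultimately show False using infinite_window[OF assms(2), of N] by simp
qed

text \<open>
  This replaces subsequences by visits to neighbourhoods; the two directions of
  \<open>omega_limit_disjunctive\<close> below construct or exclude such visits.
\<close>

lemma omega_limit_iff_frequently:
  fixes F :: "'a::first_countable_topology \<Rightarrow> 'a"
  shows "y \<in> omega_limit F z \<longleftrightarrow> (\<forall>U n0. open U \<longrightarrow> y \<in> U \<longrightarrow> (\<exists>n\<ge>n0. (F ^^ n) z \<in> U))"
    (is "?L \<longleftrightarrow> ?R")
proof
  assume ?L
  then obtain r where r: "filterlim r at_top sequentially" "(\<lambda>j. (F ^^ r j) z) \<longlonglongrightarrow> y"
    by (auto simp: omega_limit_def)
  show ?R
  proof (intro allI impI)
    fix U and n0 :: nat assume "open U" "y \<in> U"
    then have "eventually (\<lambda>j. (F ^^ r j) z \<in> U) sequentially" using r(2) topological_tendstoD by blast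
    moreover have "eventually (\<lambda>j. n0 \<le> r j) sequentially" using r(1) by (simp add: filterlim_at_top)
    ultimately have "eventually (\<lambda>j. n0 \<le> r j \<and> (F ^^ r j) z \<in> U) sequentially"
      by eventually_elim auto
    then show "\<exists>n\<ge>n0. (F ^^ n) z \<in> U" using eventually_happens'[OF sequentially_bot] by fastforce
  qed
next
  assume R: ?R
  obtain V where V: "\<And>i. open (V i)" "\<And>i. y \<in> V i"
    "\<And>S. open S \<Longrightarrow> y \<in> S \<Longrightarrow> eventually (\<lambda>i. V i \<subseteq> S) sequentially"
    using countable_basis_at_decseq[of y] by metis
  have "\<forall>i. \<exists>n\<ge>i. (F ^^ n) z \<in> V i" using R V(1,2) by blast
  then obtain r where r: "\<And>i. i \<le> r i" "\<And>i. (F ^^ r i) z \<in> V i" by metis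
  have "filterlim r at_top sequentially"
    using filterlim_at_top_mono[OF filterlim_ident] r(1) by (metis always_eventually)
  moreover have "(\<lambda>j. (F ^^ r j) z) \<longlonglongrightarrow> y"
  proof (rule topological_tendstoI)
    fix S assume "open S" "y \<in> S"
    then have "eventually (\<lambda>i. V i \<subseteq> S) sequentially" by (rule V(3))
    then show "eventually (\<lambda>i. (F ^^ r i) z \<in> S) sequentially"
      by (rule eventually_mono) (use r(2) in blast)
  qed
  ultimately show ?L by (auto simp: omega_limit_def)
qed

section \<open>The coding map\<close>

locale injective_skew =
  fixes F :: skew_map
  assumes skew: "F \<in> step_skew_products"
    and injective: "i \<in> {1..4} \<Longrightarrow> inj_on (fiber_map F i) {0..1}"
begin

abbreviation bc :: "(int \<Rightarrow> nat) \<Rightarrow> nat \<Rightarrow> real \<Rightarrow> real" where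
  "bc \<equiv> backward_comp F"

lemma fiber_map_cont: "i \<in> {1..4} \<Longrightarrow> continuous_on {0..1} (fiber_map F i)"
  using fiber_map_in_C1_maps[OF skew] differentiable_imp_continuous_on by (auto simp: C1_maps_def)

lemma fiber_map_in: "i \<in> {1..4} \<Longrightarrow> x \<in> {0..1} \<Longrightarrow> fiber_map F i x \<in> {0..1}"
  using fiber_map_in_C1_maps[OF skew] by (force simp: C1_maps_def)

lemma skew_eq:
  assumes "\<theta> \<in> \<Sigma>4" "x \<in> {0..1}"
  shows "F (\<theta>, x) = (shift \<theta>, fiber_map F (\<theta> 0) x)"
proof -
  obtain f where f: "f \<in> {1..4} \<rightarrow>\<^sub>E C1_maps" "F = step_skew f"
    using skew by (auto simp: step_skew_products_def)
  moreover have "\<theta> 0 \<in> {1..4}" using assms by (auto simp: \<Sigma>4_def)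
  ultimately show ?thesis
    using assms fiber_map_step_skew[OF f(1), of "\<theta> 0"] by (simp add: step_skew_def)
qed

lemma bc_in_cont_inj:
  assumes "\<theta> \<in> \<Sigma>4"
  shows "bc \<theta> n ` {0..1} \<subseteq> {0..1} \<and> continuous_on {0..1} (bc \<theta> n) \<and> inj_on (bc \<theta> n) {0..1}"
proof (induction n)
  case (Suc n)
  let ?i = "\<theta> (- int (Suc n))"
  have i: "?i \<in> {1..4}" using assms unfolding \<Sigma>4_def by blast
  have sub: "fiber_map F ?i ` {0..1} \<subseteq> {0..1}" using fiber_map_in[OF i] by blast
  have "continuous_on {0..1} (bc \<theta> (Suc n))"
    unfolding backward_comp.simps
    by (rule continuous_on_compose[OF fiber_map_cont[OF i]]) (use Suc sub continuous_on_subset in blast)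
  moreover have "inj_on (bc \<theta> (Suc n)) {0..1}"
    unfolding backward_comp.simps
    by (rule comp_inj_on[OF injective[OF i]]) (use Suc sub inj_on_subset in blast)
  moreover have "bc \<theta> (Suc n) ` {0..1} \<subseteq> {0..1}"
    using Suc sub by (auto simp: image_comp[symmetric] simp del: of_nat_Suc)
  ultimately show ?case by blast
qed auto

lemmas bc_image = bc_in_cont_inj[THEN conjunct1]
lemmas bc_cont = bc_in_cont_inj[THEN conjunct2, THEN conjunct1]
lemmas bc_inj = bc_in_cont_inj[THEN conjunct2, THEN conjunct2]

lemma bc_in: "\<theta> \<in> \<Sigma>4 \<Longrightarrow> x \<in> {0..1} \<Longrightarrow> bc \<theta> n x \<in> {0..1}"
  using bc_image by blast

lemma bc_cong:
  assumes "\<And>k. - int n \<le> k \<Longrightarrow> k < 0 \<Longrightarrow> \<theta> k = \<theta>' k"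
  shows "bc \<theta> n = bc \<theta>' n"
  using assms by (induction n) auto

text \<open>
  The composition along the past factors through the sequence shifted by \<open>N\<close>. All
  statements about replacing the remote past of a sequence rest on this.
\<close>

lemma bc_add: "bc \<theta> (N + n) = bc \<theta> N \<circ> bc (\<lambda>k. \<theta> (k - int N)) n"
proof (induction n)
  case (Suc n)
  have e: "- int (N + Suc n) = - int (Suc n) - int N" by simp
  have "bc \<theta> (N + Suc n) = bc \<theta> (N + n) \<circ> fiber_map F (\<theta> (- int (N + Suc n)))"
    by simp
  then show ?case unfolding Suc e by (simp add: comp_assoc)
qed auto

lemma bc_antimono:
  assumes "\<theta> \<in> \<Sigma>4" "n \<le> k"
  shows "bc \<theta> k ` {0..1} \<subseteq> bc \<theta> n ` {0..1}"
proof -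
  have "(\<lambda>k. \<theta> (k - int n)) \<in> \<Sigma>4" using assms by (auto simp: \<Sigma>4_def)
  then have "bc (\<lambda>k. \<theta> (k - int n)) (k - n) ` {0..1} \<subseteq> {0..1}" by (rule bc_image)
  then show ?thesis using bc_add[of \<theta> n "k - n"] assms(2) by auto
qed

lemma weakly_hyperbolic_imp_\<Sigma>4: "\<theta> \<in> weakly_hyperbolic F \<Longrightarrow> \<theta> \<in> \<Sigma>4"
  by (simp add: weakly_hyperbolic_def)

text \<open>
  The images \<open>bc \<theta> n ` {0..1}\<close> decrease and are compact, so when they shrink to a point they
  eventually lie in any ball around it.
\<close>

lemma weakly_hyperbolic_uniform:
  assumes \<theta>: "\<theta> \<in> \<Sigma>4" and y: "(\<Inter>n. bc \<theta> n ` {0..1}) = {y}" and e: "e > 0"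
  shows "\<exists>N. \<forall>n\<ge>N. \<forall>p\<in>{0..1}. \<bar>bc \<theta> n p - y\<bar> < e"
proof -
  let ?F = "\<lambda>n. bc \<theta> n ` {0..1} - ball y e"
  have "\<exists>N. ?F N = {}"
  proof (rule ccontr)
    assume "\<not> ?thesis"
    then have "\<Inter>(range ?F) \<noteq> {}"
    proof (intro compact_nest)
      show "compact (?F n)" for n
        by (intro compact_diff compact_continuous_image bc_cont[OF \<theta>] compact_Icc open_ball)
      show "m \<le> n \<Longrightarrow> ?F n \<subseteq> ?F m" for m n using bc_antimono[OF \<theta>] by blast
    qed auto
    moreover have "\<Inter>(range ?F) \<subseteq> {y} - ball y e" unfolding y[symmetric] by blast
    ultimately show False using e by auto
  qed
  then obtain N where N: "bc \<theta> N ` {0..1} \<subseteq> ball y e" by blast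
  then have "bc \<theta> n p \<in> ball y e" if "n \<ge> N" "p \<in> {0..1}" for n p
    using bc_antimono[OF \<theta> that(1)] that(2) by blast
  then show ?thesis unfolding mem_ball dist_real_def by (metis abs_minus_commute)
qed

lemma coding_map_eqI:
  assumes \<theta>: "\<theta> \<in> \<Sigma>4" and y: "(\<Inter>n. bc \<theta> n ` {0..1}) = {y}"
  shows "\<theta> \<in> weakly_hyperbolic F" "coding_map F \<theta> = y"
proof -
  show "\<theta> \<in> weakly_hyperbolic F" using assms by (simp add: weakly_hyperbolic_def)
  have lim: "(\<lambda>n. bc \<theta> n p) \<longlonglongrightarrow> y" if "p \<in> {0..1}" for p
    using weakly_hyperbolic_uniform[OF assms] that unfolding LIMSEQ_iff real_norm_def by meson
  show "coding_map F \<theta> = y"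
    unfolding coding_map_def
  proof (rule the_equality)
    show "z = y" if "\<forall>p\<in>{0..1}. (\<lambda>n. bc \<theta> n p) \<longlonglongrightarrow> z" for z
      using that lim[of 0] LIMSEQ_unique by (metis atLeastAtMost_iff order_refl zero_le_one)
  qed (use lim in blast)
qed

lemma coding_map_core:
  assumes "\<theta> \<in> weakly_hyperbolic F"
  shows "(\<Inter>n. bc \<theta> n ` {0..1}) = {coding_map F \<theta>}"
proof -
  obtain y where "(\<Inter>n. bc \<theta> n ` {0..1}) = {y}"
    using assms by (auto simp: weakly_hyperbolic_def elim: is_singletonE)
  then show ?thesis using coding_map_eqI assms weakly_hyperbolic_imp_\<Sigma>4 by metis
qed

lemma coding_map_in: "\<theta> \<in> weakly_hyperbolic F \<Longrightarrow> coding_map F \<theta> \<in> {0..1}"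
  using coding_map_core[of \<theta>] by (auto dest!: equalityD2 INT_D[where a=0])

text \<open>
  Injectivity makes images commute with the intersection. As it also preserves the property of being
  a singleton, weak hyperbolicity is independent of any finite part of the past.
\<close>

lemma core_shift:
  assumes \<theta>: "\<theta> \<in> \<Sigma>4"
  shows "(\<Inter>n. bc \<theta> n ` {0..1}) = bc \<theta> N ` (\<Inter>n. bc (\<lambda>k. \<theta> (k - int N)) n ` {0..1})"
proof -
  let ?\<tau> = "\<lambda>k. \<theta> (k - int N)"
  have \<tau>: "?\<tau> \<in> \<Sigma>4" using \<theta> by (auto simp: \<Sigma>4_def)
  have "(\<Inter>n. bc \<theta> n ` {0..1}) = (\<Inter>n. bc \<theta> (N + n) ` {0..1})"
    using bc_antimono[OF \<theta>, of _ "N + _"] by (auto intro!: equalityI INT_greatest) (meson le_add2 image_eqI subsetD)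
  also have "\<dots> = (\<Inter>n. bc \<theta> N ` (bc ?\<tau> n ` {0..1}))"
    by (simp add: bc_add image_comp)
  also have "\<dots> = bc \<theta> N ` (\<Inter>n. bc ?\<tau> n ` {0..1})"
    by (rule image_INT[symmetric, OF bc_inj[OF \<theta>, of N], of UNIV]) (use bc_image[OF \<tau>] in auto)
  finally show ?thesis .
qed

lemma coding_map_shift:
  assumes \<theta>: "\<theta> \<in> \<Sigma>4"
  shows "\<theta> \<in> weakly_hyperbolic F \<longleftrightarrow> (\<lambda>k. \<theta> (k - int N)) \<in> weakly_hyperbolic F"
    and "\<theta> \<in> weakly_hyperbolic F \<Longrightarrow> coding_map F \<theta> = bc \<theta> N (coding_map F (\<lambda>k. \<theta> (k - int N)))"
proof -
  let ?\<tau> = "\<lambda>k. \<theta> (k - int N)"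
  let ?X = "\<Inter>n. bc ?\<tau> n ` {0..1}"
  have \<tau>: "?\<tau> \<in> \<Sigma>4" using \<theta> by (auto simp: \<Sigma>4_def)
  have sub: "?X \<subseteq> {0..1}" using bc_image[OF \<tau>] by blast
  have inj: "inj_on (bc \<theta> N) ?X" using bc_inj[OF \<theta>] sub inj_on_subset by blast
  show iff: "\<theta> \<in> weakly_hyperbolic F \<longleftrightarrow> ?\<tau> \<in> weakly_hyperbolic F"
    unfolding weakly_hyperbolic_def mem_Collect_eq core_shift[OF \<theta>, of N]
    using \<theta> \<tau> card_image[OF inj] by (simp add: is_singleton_altdef)
  show "coding_map F \<theta> = bc \<theta> N (coding_map F ?\<tau>)" if "\<theta> \<in> weakly_hyperbolic F"
    using core_shift[OF \<theta>, of N] coding_map_core[OF that] coding_map_core[of ?\<tau>] iff that by simp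
qed

section \<open>The closure of the graph and the limit sets\<close>

text \<open>
  By compactness of \<open>\<Sigma>4\<close> this is the projection of the closure of the graph to \<open>{0..1}\<close>.
\<close>

definition attractor :: "real set" where
  "attractor = closure (coding_map F ` weakly_hyperbolic F)"

lemma attractor_subset: "attractor \<subseteq> {0..1}"
  unfolding attractor_def by (rule closure_minimal) (use coding_map_in in auto)

lemma compact_attractor: "compact attractor"
  using attractor_subset compact_Icc[of 0 "1::real"] unfolding attractor_def
  by (metis closed_closure compact_Int_closed inf.absorb_iff2)

lemma compact_bc_attractor: "\<theta> \<in> \<Sigma>4 \<Longrightarrow> compact (bc \<theta> n ` attractor)"
  using compact_continuous_image[OF continuous_on_subset[OF bc_cont attractor_subset] compact_attractor] .

text \<open>
  Inserting the symbol \<open>i\<close> at the most recent position of the past of \<open>\<tau>\<close> applies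
  \<open>fiber_map F i\<close> to the value of the coding map.
\<close>

lemma fiber_map_attractor:
  assumes i: "i \<in> {1..4}"
  shows "fiber_map F i ` attractor \<subseteq> attractor"
proof -
  have "fiber_map F i ` closure (coding_map F ` weakly_hyperbolic F)
      \<subseteq> closure (coding_map F ` weakly_hyperbolic F)"
  proof (rule image_closure_subset)
    show "continuous_on (closure (coding_map F ` weakly_hyperbolic F)) (fiber_map F i)"
      using continuous_on_subset[OF fiber_map_cont[OF i] attractor_subset] by (simp add: attractor_def)
    have "fiber_map F i (coding_map F \<tau>) \<in> coding_map F ` weakly_hyperbolic F"
      if \<tau>: "\<tau> \<in> weakly_hyperbolic F" for \<tau>
    proof -
      define \<theta> where "\<theta> = (\<lambda>k. if k = -1 then i else \<tau> (k + 1))"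
      have \<theta>: "\<theta> \<in> \<Sigma>4" using i weakly_hyperbolic_imp_\<Sigma>4[OF \<tau>] by (auto simp: \<theta>_def \<Sigma>4_def)
      have bc\<theta>: "bc (\<lambda>k. \<theta> (k - int 1)) = bc \<tau>"
        by (rule ext, rule bc_cong) (auto simp: \<theta>_def)
      have "(\<lambda>k. \<theta> (k - int 1)) \<in> \<Sigma>4" using \<theta> by (auto simp: \<Sigma>4_def)
      from coding_map_eqI[OF this, unfolded bc\<theta>, OF coding_map_core[OF \<tau>]]
      have "\<theta> \<in> weakly_hyperbolic F" "coding_map F \<theta> = bc \<theta> 1 (coding_map F \<tau>)"
        using coding_map_shift[OF \<theta>, of 1] by auto
      then have "fiber_map F i (coding_map F \<tau>) = coding_map F \<theta>" by (simp add: \<theta>_def)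
      then show ?thesis using \<open>\<theta> \<in> weakly_hyperbolic F\<close> by blast
    qed
    then show "fiber_map F i ` coding_map F ` weakly_hyperbolic F
        \<subseteq> closure (coding_map F ` weakly_hyperbolic F)"
      using closure_subset by blast
  qed simp
  then show ?thesis by (simp add: attractor_def)
qed

lemma bc_attractor_antimono:
  assumes "\<theta> \<in> \<Sigma>4" "n \<le> k"
  shows "bc \<theta> k ` attractor \<subseteq> bc \<theta> n ` attractor"
  using assms(2)
proof (induction k rule: dec_induct)
  case (step k)
  have "\<theta> (- int (Suc k)) \<in> {1..4}" using assms(1) unfolding \<Sigma>4_def by blast
  from fiber_map_attractor[OF this] have "bc \<theta> (Suc k) ` attractor \<subseteq> bc \<theta> k ` attractor"
    by (auto simp: image_comp[symmetric] simp del: of_nat_Suc)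
  then show ?case using step by blast
qed auto

text \<open>
  The fibre of the closure of the graph over \<open>\<theta>\<close>. A sequence of the domain of the coding map
  that agrees with \<open>\<theta>\<close> on a long window has its value in the image of the attractor under
  the corresponding composition; conversely, the past of \<open>\<theta>\<close> beyond the window can be
  replaced by any weakly hyperbolic past, so all values of the attractor are nearly attained.
\<close>

lemma closure_coding_graph_iff:
  "(\<theta>, y) \<in> closure (coding_graph F) \<longleftrightarrow> \<theta> \<in> \<Sigma>4 \<and> (\<forall>N. y \<in> bc \<theta> N ` attractor)"
proof
  assume L: "(\<theta>, y) \<in> closure (coding_graph F)"
  have "closure (coding_graph F) \<subseteq> \<Sigma>4 \<times> UNIV"
    by (rule closure_minimal)
      (auto simp: coding_graph_def weakly_hyperbolic_imp_\<Sigma>4 closed_Times closed_\<Sigma>4)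
  then have \<theta>: "\<theta> \<in> \<Sigma>4" using L by auto
  have "y \<in> bc \<theta> N ` attractor" for N
  proof (rule ccontr)
    assume y: "y \<notin> bc \<theta> N ` attractor"
    let ?U = "{\<theta>'. agree_on_window N \<theta> \<theta>'} \<times> (- (bc \<theta> N ` attractor))"
    have "open ?U"
      by (intro open_Times open_window open_Compl compact_imp_closed compact_bc_attractor \<theta>)
    moreover have "(\<theta>, y) \<in> ?U" using y by (auto simp: agree_on_window_def)
    ultimately have "coding_graph F \<inter> ?U \<noteq> {}"
      using L open_Int_closure_eq_empty[of ?U "coding_graph F"] by blast
    then obtain \<tau> where \<tau>: "\<tau> \<in> weakly_hyperbolic F" "agree_on_window N \<theta> \<tau>"
      "coding_map F \<tau> \<notin> bc \<theta> N ` attractor"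
      by (auto simp: coding_graph_def)
    have "bc \<tau> N = bc \<theta> N"
      by (rule bc_cong) (use \<tau>(2) in \<open>auto simp: agree_on_window_def\<close>)
    moreover have "(\<lambda>k. \<tau> (k - int N)) \<in> weakly_hyperbolic F"
      using coding_map_shift(1)[OF weakly_hyperbolic_imp_\<Sigma>4[OF \<tau>(1)], of N] \<tau>(1) by simp
    then have "coding_map F (\<lambda>k. \<tau> (k - int N)) \<in> attractor"
      unfolding attractor_def by (intro closure_subset[THEN subsetD] imageI)
    ultimately show False
      using \<tau> coding_map_shift(2)[OF weakly_hyperbolic_imp_\<Sigma>4[OF \<tau>(1)] \<tau>(1), of N] by auto
  qed
  with \<theta> show "\<theta> \<in> \<Sigma>4 \<and> (\<forall>N. y \<in> bc \<theta> N ` attractor)" by blast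
next
  assume R: "\<theta> \<in> \<Sigma>4 \<and> (\<forall>N. y \<in> bc \<theta> N ` attractor)"
  then have \<theta>: "\<theta> \<in> \<Sigma>4" by blast
  show "(\<theta>, y) \<in> closure (coding_graph F)"
  proof (rule closure_iff_nhds_not_empty[THEN iffD2], intro allI impI)
    fix A U assume "U \<subseteq> A" "open U" "(\<theta>, y) \<in> U"
    then obtain N e where Ne: "e > 0"
      "\<And>\<theta>' y'. agree_on_window N \<theta> \<theta>' \<Longrightarrow> \<bar>y' - y\<bar> < e \<Longrightarrow> (\<theta>', y') \<in> U"
      using open_Times_contains_window by metis
    obtain x where x: "x \<in> attractor" "y = bc \<theta> N x" using R by blast
    have "x \<in> {0..1}" using x(1) attractor_subset by blast
    then obtain d where d: "d > 0" "\<And>x'. x' \<in> {0..1} \<Longrightarrow> dist x' x < d \<Longrightarrow> dist (bc \<theta> N x') (bc \<theta> N x) < e"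
      using bc_cont[OF \<theta>, of N] Ne(1) unfolding continuous_on_iff by metis
    obtain \<tau> where \<tau>: "\<tau> \<in> weakly_hyperbolic F" "dist (coding_map F \<tau>) x < d"
      using x(1) d(1) unfolding attractor_def closure_approachable by blast
    define \<theta>' where "\<theta>' = (\<lambda>k. if k < - int N then \<tau> (k + int N) else \<theta> k)"
    have \<theta>': "\<theta>' \<in> \<Sigma>4"
      using \<theta> weakly_hyperbolic_imp_\<Sigma>4[OF \<tau>(1)] by (auto simp: \<theta>'_def \<Sigma>4_def)
    have bc\<tau>: "bc (\<lambda>k. \<theta>' (k - int N)) = bc \<tau>"
      by (rule ext, rule bc_cong) (auto simp: \<theta>'_def)
    have bc\<theta>: "bc \<theta>' N = bc \<theta> N" by (rule bc_cong) (auto simp: \<theta>'_def)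
    have "(\<lambda>k. \<theta>' (k - int N)) \<in> \<Sigma>4" using \<theta>' by (auto simp: \<Sigma>4_def)
    from coding_map_eqI[OF this, unfolded bc\<tau>, OF coding_map_core[OF \<tau>(1)]]
    have c: "\<theta>' \<in> weakly_hyperbolic F" "coding_map F \<theta>' = bc \<theta> N (coding_map F \<tau>)"
      using coding_map_shift[OF \<theta>', of N] bc\<theta> by auto
    have "dist (coding_map F \<theta>') y < e"
      unfolding c(2) x(2) by (rule d(2)[OF coding_map_in[OF \<tau>(1)] \<tau>(2)])
    then have "(\<theta>', coding_map F \<theta>') \<in> U"
      by (intro Ne(2)) (auto simp: agree_on_window_def \<theta>'_def dist_real_def)
    then show "coding_graph F \<inter> A \<noteq> {}"
      using c(1) \<open>U \<subseteq> A\<close> by (auto simp: coding_graph_def)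
  qed
qed

lemma orbit_eq:
  assumes "\<theta> \<in> \<Sigma>4" "x \<in> {0..1}"
  shows "(F ^^ n) (\<theta>, x) = ((shift ^^ n) \<theta>, bc ((shift ^^ n) \<theta>) n x)"
proof (induction n)
  case (Suc n)
  let ?\<tau> = "(shift ^^ n) \<theta>"
  have \<tau>: "?\<tau> \<in> \<Sigma>4" using shift_funpow_in_\<Sigma>4 assms by blast
  have "bc ((shift ^^ Suc n) \<theta>) (1 + n) = fiber_map F (?\<tau> 0) \<circ> bc ?\<tau> n"
    unfolding bc_add by (simp add: shift_def)
  then show ?case using Suc skew_eq[OF \<tau> bc_in[OF \<tau> assms(2)]] by (simp add: fun_eq_iff)
qed simp

text \<open>
  The fibre coordinate of an orbit is the composition along the last \<open>N\<close> symbols, applied to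
  an earlier fibre coordinate. So a long contracting word in the recent past determines it
  up to a small error, whatever the initial point was.
\<close>

lemma orbit_window:
  assumes "\<theta> \<in> \<Sigma>4" "x \<in> {0..1}" "N \<le> n"
  shows "snd ((F ^^ n) (\<theta>, x)) = bc ((shift ^^ n) \<theta>) N (snd ((F ^^ (n - N)) (\<theta>, x)))"
proof -
  have "(\<lambda>k. (shift ^^ n) \<theta> (k - int N)) = (shift ^^ (n - N)) \<theta>"
    using assms(3) by (auto simp: shift_funpow fun_eq_iff algebra_simps of_nat_diff)
  then show ?thesis
    using bc_add[of "(shift ^^ n) \<theta>" N "n - N"] assms by (simp add: orbit_eq fun_eq_iff)
qed

lemma orbit_in:
  assumes "\<theta> \<in> \<Sigma>4" "x \<in> {0..1}"
  shows "snd ((F ^^ n) (\<theta>, x)) \<in> {0..1}"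
  using orbit_eq[OF assms] bc_in shift_funpow_in_\<Sigma>4 assms by simp

lemma orbit_stays_in_attractor:
  assumes "\<theta> \<in> \<Sigma>4" "x \<in> {0..1}" "snd ((F ^^ n) (\<theta>, x)) \<in> attractor" "n \<le> k"
  shows "snd ((F ^^ k) (\<theta>, x)) \<in> attractor"
  using assms(4)
proof (induction k rule: dec_induct)
  case base
  show ?case by (rule assms(3))
next
  case (step k)
  have "\<theta> (int k) \<in> {1..4}" using assms(1) unfolding \<Sigma>4_def by blast
  moreover have "snd ((F ^^ Suc k) (\<theta>, x)) = fiber_map F (\<theta> (int k)) (snd ((F ^^ k) (\<theta>, x)))"
    using orbit_window[OF assms(1,2), of 1 "Suc k"] by (simp add: shift_funpow del: funpow.simps)
  ultimately show ?case using step fiber_map_attractor by auto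
qed

text \<open>
  A disjunctive sequence contains every word infinitely often. Reading a long piece of the past
  of a weakly hyperbolic sequence brings the orbit close to the point of the graph, which yields
  one inclusion. For the other one the orbit has to approach the attractor even when it starts
  outside: the symbol \<open>i\<close>, whose fibre map sends all of \<open>{0..1}\<close> into the attractor,
  occurs at some time, and afterwards the invariant attractor is not left.
\<close>

proposition omega_limit_disjunctive:
  assumes dis: "disjunctive \<theta>" and x: "x \<in> {0..1}"
    and absorbing: "i \<in> {1..4}" "fiber_map F i ` {0..1} \<subseteq> attractor"
  shows "omega_limit F (\<theta>, x) = closure (coding_graph F)"
proof (rule subset_antisym)
  have \<theta>: "\<theta> \<in> \<Sigma>4" using dis by (simp add: disjunctive_def)
  show "closure (coding_graph F) \<subseteq> omega_limit F (\<theta>, x)"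
  proof (rule subsetI, unfold omega_limit_iff_frequently, intro allI impI)
    fix z :: "(int \<Rightarrow> nat) \<times> real" and U and n0 :: nat
    assume z: "z \<in> closure (coding_graph F)" "open U" "z \<in> U"
    then have "coding_graph F \<inter> U \<noteq> {}"
      using open_Int_closure_eq_empty[of U "coding_graph F"] by blast
    then obtain \<tau> where \<tau>: "\<tau> \<in> weakly_hyperbolic F" "(\<tau>, coding_map F \<tau>) \<in> U"
      by (auto simp: coding_graph_def)
    have \<tau>4: "\<tau> \<in> \<Sigma>4" by (rule weakly_hyperbolic_imp_\<Sigma>4[OF \<tau>(1)])
    obtain N e where Ne: "e > 0"
      "\<And>\<theta>' y'. agree_on_window N \<tau> \<theta>' \<Longrightarrow> \<bar>y' - coding_map F \<tau>\<bar> < e \<Longrightarrow> (\<theta>', y') \<in> U"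
      using open_Times_contains_window[OF z(2) \<tau>(2)] by metis
    obtain M where M: "\<And>p. p \<in> {0..1} \<Longrightarrow> \<bar>bc \<tau> (max M N) p - coding_map F \<tau>\<bar> < e"
      using weakly_hyperbolic_uniform[OF \<tau>4 coding_map_core[OF \<tau>(1)] Ne(1)] by (meson max.cobounded1)
    let ?M = "max M N"
    obtain n where n: "n \<ge> max n0 ?M" "agree_on_window ?M \<tau> ((shift ^^ n) \<theta>)"
      using disjunctive_infinitely_often[OF dis \<tau>4] by metis
    have "bc ((shift ^^ n) \<theta>) ?M = bc \<tau> ?M"
      by (rule bc_cong) (use n(2) in \<open>auto simp: agree_on_window_def\<close>)
    then have "\<bar>snd ((F ^^ n) (\<theta>, x)) - coding_map F \<tau>\<bar> < e"
      using orbit_window[OF \<theta> x, of ?M n] M[OF orbit_in[OF \<theta> x]] n(1) by simp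
    moreover have "agree_on_window N \<tau> ((shift ^^ n) \<theta>)"
      using n(2) unfolding agree_on_window_def by fastforce
    ultimately have "(F ^^ n) (\<theta>, x) \<in> U"
      using Ne(2) orbit_eq[OF \<theta> x, of n] by simp
    then show "\<exists>n\<ge>n0. (F ^^ n) (\<theta>, x) \<in> U" using n(1) by auto
  qed
  show "omega_limit F (\<theta>, x) \<subseteq> closure (coding_graph F)"
  proof
    fix z assume z: "z \<in> omega_limit F (\<theta>, x)"
    obtain \<tau> y where ty: "z = (\<tau>, y)" by fastforce
    have "\<tau> \<in> \<Sigma>4"
    proof (rule ccontr)
      assume "\<tau> \<notin> \<Sigma>4"
      moreover have "open ((- \<Sigma>4) \<times> (UNIV :: real set))"
        by (intro open_Times open_Compl closed_\<Sigma>4 open_UNIV)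
      moreover have "z \<in> (- \<Sigma>4) \<times> UNIV" using ty \<open>\<tau> \<notin> \<Sigma>4\<close> by simp
      ultimately have "\<exists>n\<ge>0. (F ^^ n) (\<theta>, x) \<in> (- \<Sigma>4) \<times> UNIV"
        using z unfolding omega_limit_iff_frequently by blast
      then show False using orbit_eq[OF \<theta> x] shift_funpow_in_\<Sigma>4[OF \<theta>] by auto
    qed
    have "(\<lambda>_. i) \<in> \<Sigma>4" using absorbing(1) by (simp add: \<Sigma>4_def)
    from disjunctive_infinitely_often[OF dis this, of 1 1]
    obtain n1 where n1: "n1 \<ge> 1" "(shift ^^ n1) \<theta> (-1) = i"
      by (auto simp: agree_on_window_def)
    have "snd ((F ^^ n1) (\<theta>, x)) = fiber_map F i (snd ((F ^^ (n1 - 1)) (\<theta>, x)))"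
      using orbit_window[OF \<theta> x n1(1)] n1(2) by simp
    then have in_attr: "snd ((F ^^ n) (\<theta>, x)) \<in> attractor" if "n \<ge> n1" for n
      using orbit_stays_in_attractor[OF \<theta> x _ that] orbit_in[OF \<theta> x, of "n1 - 1"] absorbing(2)
      by (metis image_subset_iff)
    have "y \<in> bc \<tau> N ` attractor" for N
    proof (rule ccontr)
      assume "y \<notin> bc \<tau> N ` attractor"
      let ?U = "{\<theta>'. agree_on_window N \<tau> \<theta>'} \<times> (- (bc \<tau> N ` attractor))"
      have "open ?U"
        by (intro open_Times open_window open_Compl compact_imp_closed compact_bc_attractor \<open>\<tau> \<in> \<Sigma>4\<close>)
      moreover have "z \<in> ?U"
        using \<open>y \<notin> bc \<tau> N ` attractor\<close> by (auto simp: agree_on_window_def ty)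
      ultimately obtain n where n: "n \<ge> n1 + N" "(F ^^ n) (\<theta>, x) \<in> ?U"
        using z unfolding omega_limit_iff_frequently by metis
      have "bc ((shift ^^ n) \<theta>) N = bc \<tau> N"
        by (rule bc_cong) (use n(2) in \<open>auto simp: agree_on_window_def orbit_eq[OF \<theta> x]\<close>)
      then show False
        using orbit_window[OF \<theta> x, of N n] in_attr[of "n - N"] n
        by (auto simp: image_iff)
    qed
    then show "z \<in> closure (coding_graph F)"
      using \<open>\<tau> \<in> \<Sigma>4\<close> by (simp add: ty closure_coding_graph_iff)
  qed
qed

end

section \<open>Systems of blocks\<close>

text \<open>
  The barrier \<open>a\<close> is pushed to the right, so the decreasing iterates of \<open>c'\<close> cannot cross it.
  Their limit is fixed, hence lies outside the interval \<open>{c..c'}\<close> without fixed points.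
\<close>

lemma iterates_decrease_to_fixed_point:
  fixes g :: "real \<Rightarrow> real"
  assumes cont: "continuous_on {0..1} g" and mono: "strict_mono_on {0..1} g"
    and ord: "0 \<le> a" "a < c" "c \<le> c'" "c' \<le> 1"
    and a: "a < g a" and c: "\<And>x. x \<in> {c..c'} \<Longrightarrow> g x < x"
  shows "\<exists>\<alpha>. (\<lambda>n. (g ^^ n) c') \<longlonglongrightarrow> \<alpha> \<and> a \<le> \<alpha> \<and> \<alpha> < c \<and> g \<alpha> = \<alpha>"
proof -
  let ?s = "\<lambda>n. (g ^^ n) c'"
  have le: "g x \<le> g y" if "0 \<le> x" "x \<le> y" "y \<le> 1" for x y
    using mono that by (simp add: strict_mono_on_leD)
  have s: "a \<le> ?s n \<and> ?s (Suc n) \<le> ?s n \<and> ?s n \<le> c'" for n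
  proof (induction n)
    case 0
    show ?case using ord c[of c'] by simp
  next
    case (Suc n)
    then show ?case
      using le[of a "?s n"] le[of "?s (Suc n)" "?s n"] le[of a "?s (Suc n)"] a ord by auto
  qed
  have "decseq ?s" using s by (simp add: decseq_Suc_iff)
  then obtain \<alpha> where \<alpha>: "?s \<longlonglongrightarrow> \<alpha>"
    using decseq_convergent[of ?s a] s by metis
  have in1: "a \<le> \<alpha>" using LIMSEQ_le_const[OF \<alpha>] s by blast
  have in2: "\<alpha> \<le> c'" using LIMSEQ_le_const2[OF \<alpha>] s by blast
  have "(\<lambda>n. g (?s n)) \<longlonglongrightarrow> g \<alpha>"
    by (rule continuous_on_tendsto_compose[OF cont \<alpha>])
      (use in1 in2 ord s in \<open>auto intro!: always_eventually order_trans[of 0 a] order_trans[of _ c' 1]\<close>)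
  moreover have "(\<lambda>n. g (?s n)) \<longlonglongrightarrow> \<alpha>" using LIMSEQ_Suc[OF \<alpha>] by simp
  ultimately have fp: "g \<alpha> = \<alpha>" using LIMSEQ_unique by blast
  then have "\<alpha> < c" using c[of \<alpha>] in2 by force
  then show ?thesis using \<alpha> in1 fp by blast
qed

text \<open>
  The mirror image of \<open>iterates_decrease_to_fixed_point\<close> under \<open>x \<mapsto> 1 - x\<close>.
\<close>

lemma iterates_increase_to_fixed_point:
  fixes g :: "real \<Rightarrow> real"
  assumes cont: "continuous_on {0..1} g" and mono: "strict_mono_on {0..1} g"
    and ord: "0 \<le> d'" "d' \<le> d" "d < b" "b \<le> 1"
    and b: "g b < b" and d: "\<And>x. x \<in> {d'..d} \<Longrightarrow> x < g x"
  shows "\<exists>\<beta>. (\<lambda>n. (g ^^ n) d') \<longlonglongrightarrow> \<beta> \<and> d < \<beta> \<and> \<beta> \<le> b \<and> g \<beta> = \<beta>"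
proof -
  define h where "h x = 1 - g (1 - x)" for x
  have "(h ^^ n) (1 - x) = 1 - (g ^^ n) x" for n x
    by (induction n) (auto simp: h_def)
  note iter = this
  have "\<exists>\<alpha>. (\<lambda>n. (h ^^ n) (1 - d')) \<longlonglongrightarrow> \<alpha> \<and> 1 - b \<le> \<alpha> \<and> \<alpha> < 1 - d \<and> h \<alpha> = \<alpha>"
  proof (rule iterates_decrease_to_fixed_point)
    show "continuous_on {0..1} h"
      unfolding h_def by (intro continuous_intros continuous_on_compose2[OF cont]) auto
    show "strict_mono_on {0..1} h"
      using mono by (auto simp: strict_mono_on_def h_def)
    show "h x < x" if "x \<in> {1 - d..1 - d'}" for x
      using d[of "1 - x"] that by (auto simp: h_def)
  qed (use ord b in \<open>auto simp: h_def\<close>)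
  then obtain \<alpha> where \<alpha>: "(\<lambda>n. 1 - (g ^^ n) d') \<longlonglongrightarrow> \<alpha>" "1 - b \<le> \<alpha>" "\<alpha> < 1 - d" "h \<alpha> = \<alpha>"
    unfolding iter by blast
  have "(\<lambda>n. 1 - (1 - (g ^^ n) d')) \<longlonglongrightarrow> 1 - \<alpha>" by (intro tendsto_intros \<alpha>(1))
  moreover have "g (1 - \<alpha>) = 1 - \<alpha>" using \<alpha>(4) by (simp add: h_def)
  ultimately show ?thesis using \<alpha>(2,3) by (intro exI[of _ "1 - \<alpha>"]) auto
qed

text \<open>
  Around each of the \<open>m\<close> future blocks there are points
  \<open>a i < c i < c' i < d' i < d i < b i\<close>. The innermost interval \<open>{c' i..d' i}\<close> is the core of the
  block, \<open>{c i..d i}\<close> is certainly contained in the block, and \<open>{a i..b i}\<close> certainly contains it: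
  the first fibre map expands the core until its iterates stop between \<open>a i\<close> and \<open>c i\<close> on the
  left and between \<open>d i\<close> and \<open>b i\<close> on the right. The second and third fibre maps are contractions
  into the first block whose images of the first core cover that core. The fourth one moves each
  block into the next one, and the last block into itself, and the image of each core covers
  the next core.

  All hypotheses on the fibre maps apart from monotonicity and contraction are inequalities
  between values, required at finitely many points or on compact intervals. In strict form they
  persist under small perturbations while the points \<open>a\<close>, \<dots>, \<open>b\<close> stay the same.
\<close>

locale block_system =
  fixes F :: skew_map and m :: nat and a c c' d' d b :: "nat \<Rightarrow> real"
  assumes skew: "F \<in> step_skew_products"
    and increasing: "j \<in> {1..4} \<Longrightarrow> strict_mono_on {0..1} (fiber_map F j)"
    and m: "m \<ge> 1"
    and order: "i < m \<Longrightarrow> 0 \<le> a i \<and> a i < c i \<and> c i < c' i \<and> c' i < d' i \<and> d' i < d i \<and> d i < b i \<and> b i \<le> 1"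
    and separated: "i < j \<Longrightarrow> j < m \<Longrightarrow> b j < a i"
    and trapping: "i < m \<Longrightarrow> a i < fiber_map F 1 (a i)" "i < m \<Longrightarrow> fiber_map F 1 (b i) < b i"
    and repelling: "i < m \<Longrightarrow> x \<in> {c i..c' i} \<Longrightarrow> fiber_map F 1 x < x"
      "i < m \<Longrightarrow> x \<in> {d' i..d i} \<Longrightarrow> x < fiber_map F 1 x"
    and contracting: "j \<in> {2, 3} \<Longrightarrow> x \<in> {0..1} \<Longrightarrow> y \<in> {0..1} \<Longrightarrow>
      \<bar>fiber_map F j x - fiber_map F j y\<bar> \<le> 3/4 * \<bar>x - y\<bar>"
    and into_first: "j \<in> {2, 3} \<Longrightarrow> fiber_map F j ` {0..1} \<subseteq> {c 0..d 0}"
    and covering: "fiber_map F 2 (c' 0) \<le> c' 0" "fiber_map F 3 (c' 0) \<le> fiber_map F 2 (d' 0)"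
      "d' 0 \<le> fiber_map F 3 (d' 0)"
    and step_into: "i < m \<Longrightarrow> c (min (Suc i) (m - 1)) \<le> fiber_map F 4 (a i)"
      "i < m \<Longrightarrow> fiber_map F 4 (b i) \<le> d (min (Suc i) (m - 1))"
    and step_over: "Suc i < m \<Longrightarrow> fiber_map F 4 (c' i) \<le> c' (Suc i)"
      "Suc i < m \<Longrightarrow> d' (Suc i) \<le> fiber_map F 4 (d' i)"
begin

sublocale injective_skew F
  by unfold_locales (use skew increasing strict_mono_on_imp_inj_on in blast)+

lemma fiber_map_mono:
  "j \<in> {1..4} \<Longrightarrow> 0 \<le> x \<Longrightarrow> x \<le> y \<Longrightarrow> y \<le> 1 \<Longrightarrow> fiber_map F j x \<le> fiber_map F j y"
  using increasing[of j] by (simp add: strict_mono_on_leD)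

lemma fiber_map_Icc:
  assumes j: "j \<in> {1..4}" and uv: "0 \<le> u" "u \<le> v" "v \<le> 1"
  shows "fiber_map F j ` {u..v} = {fiber_map F j u..fiber_map F j v}"
proof (rule subset_antisym)
  show "fiber_map F j ` {u..v} \<subseteq> {fiber_map F j u..fiber_map F j v}"
    using fiber_map_mono[OF j] uv by auto
  have "continuous_on {u..v} (fiber_map F j)"
    using fiber_map_cont[OF j] by (rule continuous_on_subset) (use uv in auto)
  then show "{fiber_map F j u..fiber_map F j v} \<subseteq> fiber_map F j ` {u..v}"
    using IVT'[of "fiber_map F j" u _ v] uv(2) by fastforce
qed

text \<open>
  The end points of a block. The first fibre map may have several fixed points in \<open>{a i..c i}\<close> and
  \<open>{d i..b i}\<close>; the limits of the iterates select those next to the core.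
\<close>

definition \<alpha> :: "nat \<Rightarrow> real" where "\<alpha> i = lim (\<lambda>n. (fiber_map F 1 ^^ n) (c' i))"
definition \<beta> :: "nat \<Rightarrow> real" where "\<beta> i = lim (\<lambda>n. (fiber_map F 1 ^^ n) (d' i))"

lemma \<alpha>:
  assumes "i < m"
  shows "(\<lambda>n. (fiber_map F 1 ^^ n) (c' i)) \<longlonglongrightarrow> \<alpha> i" "a i \<le> \<alpha> i" "\<alpha> i < c i" "fiber_map F 1 (\<alpha> i) = \<alpha> i"
proof -
  have "\<exists>l. (\<lambda>n. (fiber_map F 1 ^^ n) (c' i)) \<longlonglongrightarrow> l \<and> a i \<le> l \<and> l < c i \<and> fiber_map F 1 l = l"
    by (rule iterates_decrease_to_fixed_point)
      (use order[OF assms] trapping[OF assms] repelling[OF assms] in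
        \<open>auto intro: fiber_map_cont increasing\<close>)
  then show "(\<lambda>n. (fiber_map F 1 ^^ n) (c' i)) \<longlonglongrightarrow> \<alpha> i" "a i \<le> \<alpha> i" "\<alpha> i < c i" "fiber_map F 1 (\<alpha> i) = \<alpha> i"
    using limI unfolding \<alpha>_def by metis+
qed

lemma \<beta>:
  assumes "i < m"
  shows "(\<lambda>n. (fiber_map F 1 ^^ n) (d' i)) \<longlonglongrightarrow> \<beta> i" "d i < \<beta> i" "\<beta> i \<le> b i" "fiber_map F 1 (\<beta> i) = \<beta> i"
proof -
  have "\<exists>l. (\<lambda>n. (fiber_map F 1 ^^ n) (d' i)) \<longlonglongrightarrow> l \<and> d i < l \<and> l \<le> b i \<and> fiber_map F 1 l = l"
    by (rule iterates_increase_to_fixed_point)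
      (use order[OF assms] trapping[OF assms] repelling[OF assms] in
        \<open>auto intro: fiber_map_cont increasing\<close>)
  then show "(\<lambda>n. (fiber_map F 1 ^^ n) (d' i)) \<longlonglongrightarrow> \<beta> i" "d i < \<beta> i" "\<beta> i \<le> b i" "fiber_map F 1 (\<beta> i) = \<beta> i"
    using limI unfolding \<beta>_def by metis+
qed

lemma \<alpha>\<beta>: "i < m \<Longrightarrow> 0 \<le> \<alpha> i \<and> \<alpha> i < \<beta> i \<and> \<beta> i \<le> 1"
  using \<alpha>(2,3)[of i] \<beta>(2,3)[of i] order[of i] by linarith

definition block :: "nat \<Rightarrow> real set" where "block i = {\<alpha> i..\<beta> i}"
definition blocks :: "real set" where "blocks = (\<Union>i<m. block i)"

lemma block_subset: "i < m \<Longrightarrow> block i \<subseteq> {0..1}"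
  using \<alpha>\<beta>[of i] by (auto simp: block_def)

lemma block_disjoint:
  assumes "i < m" "j < m" "i \<noteq> j"
  shows "block i \<inter> block j = {}"
proof -
  have "block i \<inter> block j = {}" if "i < j" "j < m" for i j
    using separated[OF that] \<alpha>(2)[of i] \<beta>(3)[of j] that by (auto simp: block_def)
  then show ?thesis using assms by (metis Int_commute nat_neq_iff)
qed

lemma block_fixed: "i < m \<Longrightarrow> fiber_map F 1 ` block i = block i"
  unfolding block_def using \<alpha>\<beta>[of i] \<alpha>(4)[of i] \<beta>(4)[of i] by (subst fiber_map_Icc) auto

text \<open>
  The second, third and fourth fibre maps send the large intervals \<open>{0..1}\<close> and \<open>{a i..b i}\<close> into
  one of the small intervals \<open>{c i..d i}\<close>, so invariance does not depend on the exact position of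
  the end points of the blocks.
\<close>

lemma blocks_invariant:
  assumes "j \<in> {1..4}"
  shows "fiber_map F j ` blocks \<subseteq> blocks"
proof -
  have "fiber_map F j x \<in> blocks" if i: "i < m" and x: "x \<in> block i" for i x
  proof -
    have x01: "x \<in> {0..1}" using block_subset i x by blast
    consider "j = 1" | "j \<in> {2, 3}" | "j = 4" using assms by force
    then show ?thesis
    proof cases
      case 1
      then show ?thesis using block_fixed[OF i] i x unfolding blocks_def by blast
    next
      case 2
      have "fiber_map F j x \<in> {c 0..d 0}" using into_first[OF 2] x01 by blast
      then show ?thesis using \<alpha>(3)[of 0] \<beta>(2)[of 0] m
        by (auto simp: blocks_def block_def intro!: bexI[of _ 0])
    next
      case 3
      let ?k = "min (Suc i) (m - 1)"
      have k: "?k < m" using i by auto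
      have "fiber_map F j x \<in> {c ?k..d ?k}"
        using 3 step_into[OF i] fiber_map_mono[of 4 "a i" x] fiber_map_mono[of 4 x "b i"]
          x \<alpha>(2)[OF i] \<beta>(3)[OF i] order[OF i] by (auto simp: block_def)
      then show ?thesis using \<alpha>(3)[OF k] \<beta>(2)[OF k] k
        unfolding blocks_def block_def by (intro UN_I[of ?k]) auto
    qed
  qed
  then show ?thesis by (auto simp: blocks_def)
qed

text \<open>
  Start the compositions at a point of the blocks: they stay there and converge to the value of
  the coding map.
\<close>

lemma attractor_subset_blocks: "attractor \<subseteq> blocks"
  unfolding attractor_def
proof (rule closure_minimal)
  show cl: "closed blocks" by (auto simp: blocks_def block_def intro!: closed_UN)
  show "coding_map F ` weakly_hyperbolic F \<subseteq> blocks"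
  proof
    fix y assume "y \<in> coding_map F ` weakly_hyperbolic F"
    then obtain \<theta> where \<theta>: "\<theta> \<in> weakly_hyperbolic F" "y = coding_map F \<theta>" by blast
    have \<theta>4: "\<theta> \<in> \<Sigma>4" by (rule weakly_hyperbolic_imp_\<Sigma>4[OF \<theta>(1)])
    have \<alpha>0: "\<alpha> 0 \<in> blocks" "\<alpha> 0 \<in> {0..1}"
      using m \<alpha>\<beta>[of 0] by (auto simp: blocks_def block_def intro!: bexI[of _ 0])
    have inv: "bc \<theta> n x \<in> blocks" if "x \<in> blocks" for n x
      using that
    proof (induction n arbitrary: x)
      case (Suc n)
      have "\<theta> (- int (Suc n)) \<in> {1..4}" using \<theta>4 unfolding \<Sigma>4_def by blast
      from blocks_invariant[OF this] Suc show ?case by auto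
    qed simp
    have "\<exists>z\<in>blocks. dist z y < e" if "e > 0" for e
      using weakly_hyperbolic_uniform[OF \<theta>4 coding_map_core[OF \<theta>(1)] that] inv[OF \<alpha>0(1)] \<alpha>0(2)
      unfolding \<theta>(2) dist_real_def by (metis order_refl)
    then show "y \<in> blocks" using closed_approachable[OF cl] by blast
  qed
qed

lemma contracting_word:
  assumes "\<theta> \<in> \<Sigma>4" "\<And>k. k < 0 \<Longrightarrow> \<theta> k \<in> {2, 3}" "p \<in> {0..1}" "q \<in> {0..1}"
  shows "\<bar>bc \<theta> n p - bc \<theta> n q\<bar> \<le> (3/4) ^ n * \<bar>p - q\<bar>"
  using assms(3,4)
proof (induction n arbitrary: p q)
  case (Suc n)
  let ?j = "\<theta> (- int (Suc n))"
  have j: "?j \<in> {2, 3}" using assms(2) by simp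
  then have j': "?j \<in> {1..4}" by auto
  have "\<bar>bc \<theta> n (fiber_map F ?j p) - bc \<theta> n (fiber_map F ?j q)\<bar>
      \<le> (3/4) ^ n * \<bar>fiber_map F ?j p - fiber_map F ?j q\<bar>"
    by (intro Suc.IH fiber_map_in j' Suc.prems)
  also have "\<dots> \<le> (3/4) ^ n * (3/4 * \<bar>p - q\<bar>)"
    by (intro mult_left_mono contracting j Suc.prems) simp
  finally show ?case by simp
qed simp

text \<open>
  Because the images of the core under the two contractions cover the core, a point of the core
  has infinitely many successive preimages within it. The symbols used form a past along which
  the compositions contract exactly to that point.
\<close>

lemma first_core_subset_attractor: "{c' 0..d' 0} \<subseteq> attractor"
proof
  fix y assume y: "y \<in> {c' 0..d' 0}"
  have C01: "{c' 0..d' 0} \<subseteq> {0..1}" using order[of 0] m by auto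
  have "\<exists>j x. j \<in> {2, 3} \<and> x \<in> {c' 0..d' 0} \<and> z = fiber_map F j x" if z: "z \<in> {c' 0..d' 0}" for z
  proof -
    have "z \<in> fiber_map F 2 ` {c' 0..d' 0} \<union> fiber_map F 3 ` {c' 0..d' 0}"
      using order[of 0] m z covering by (subst (1 2) fiber_map_Icc) auto
    then show ?thesis by blast
  qed
  then obtain J X where JX: "\<And>z. z \<in> {c' 0..d' 0} \<Longrightarrow> J z \<in> {2, 3} \<and> X z \<in> {c' 0..d' 0} \<and> z = fiber_map F (J z) (X z)"
    by metis
  have X: "(X ^^ n) y \<in> {c' 0..d' 0}" for n
    by (induction n) (use y JX in auto)
  \<comment> \<open>The preimage of the \<open>n\<close>-th point is taken under the map with the symbol at position \<open>- n - 1\<close>.\<close>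
  define \<theta> where "\<theta> k = (if k < 0 then J ((X ^^ nat (- k - 1)) y) else 2)" for k
  have past: "\<theta> k \<in> {2, 3}" for k using JX[OF X] by (simp add: \<theta>_def)
  have \<theta>: "\<theta> \<in> \<Sigma>4"
    unfolding \<Sigma>4_def mem_Collect_eq
  proof
    show "\<theta> k \<in> {1..4}" for k using past[of k] by auto
  qed
  have orbit: "bc \<theta> n ((X ^^ n) y) = y" for n
  proof (induction n)
    case (Suc n)
    have "\<theta> (- int (Suc n)) = J ((X ^^ n) y)" by (simp add: \<theta>_def)
    then show ?case using JX[OF X[of n]] Suc by simp
  qed simp
  have "(\<Inter>n. bc \<theta> n ` {0..1}) = {y}"
  proof (rule subset_antisym)
    have "y \<in> bc \<theta> n ` {0..1}" for n
      using orbit[of n] X[of n] C01 by (intro image_eqI[of _ _ "(X ^^ n) y"]) auto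
    then show "{y} \<subseteq> (\<Inter>n. bc \<theta> n ` {0..1})" by blast
    show "(\<Inter>n. bc \<theta> n ` {0..1}) \<subseteq> {y}"
    proof
      fix z assume z: "z \<in> (\<Inter>n. bc \<theta> n ` {0..1})"
      have "\<bar>z - y\<bar> \<le> (3/4) ^ n" for n
      proof -
        obtain p where p: "p \<in> {0..1}" "z = bc \<theta> n p" using z by blast
        have x: "(X ^^ n) y \<in> {0..1}" using X C01 by blast
        have "\<bar>z - y\<bar> \<le> (3/4) ^ n * \<bar>p - (X ^^ n) y\<bar>"
          using contracting_word[OF \<theta> past p(1) x, of n] p(2) orbit[of n] by simp
        also have "\<dots> \<le> (3/4) ^ n * 1"
          by (intro mult_left_mono) (use p(1) x in \<open>auto simp: abs_le_iff\<close>)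
        finally show ?thesis by simp
      qed
      moreover have "(\<lambda>n. (3/4::real) ^ n) \<longlonglongrightarrow> 0" by (rule LIMSEQ_realpow_zero) auto
      ultimately have "\<bar>z - y\<bar> \<le> 0" by (intro LIMSEQ_le_const) auto
      then show "z \<in> {y}" by simp
    qed
  qed
  note coding_map_eqI[OF \<theta> this]
  then have "y \<in> coding_map F ` weakly_hyperbolic F" by (metis imageI)
  then show "y \<in> attractor"
    unfolding attractor_def by (rule closure_subset[THEN subsetD])
qed

text \<open>
  The iterates of the core under the first fibre map are intervals in the attractor that exhaust
  the interior of the block.
\<close>

lemma block_subset_attractor:
  assumes i: "i < m" and core: "{c' i..d' i} \<subseteq> attractor"
  shows "block i \<subseteq> attractor"
proof -
  let ?u = "\<lambda>n. (fiber_map F 1 ^^ n) (c' i)" and ?v = "\<lambda>n. (fiber_map F 1 ^^ n) (d' i)"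
  have iter: "0 \<le> ?u n \<and> ?u n \<le> ?v n \<and> ?v n \<le> 1 \<and> {?u n..?v n} \<subseteq> attractor" for n
  proof (induction n)
    case 0
    show ?case using core order[OF i] by simp
  next
    case (Suc n)
    have "fiber_map F 1 ` {?u n..?v n} \<subseteq> attractor"
      using fiber_map_attractor[of 1] Suc by auto
    then show ?case
      using Suc fiber_map_Icc[of 1 "?u n" "?v n"] fiber_map_mono[of 1 "?u n" "?v n"]
        fiber_map_in[of 1 "?u n"] fiber_map_in[of 1 "?v n"] by auto
  qed
  have cl: "closed attractor" by (simp add: attractor_def)
  have "\<alpha> i \<in> attractor" "\<beta> i \<in> attractor"
    using closed_sequentially[OF cl _ \<alpha>(1)[OF i]] closed_sequentially[OF cl _ \<beta>(1)[OF i]] iter by force+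
  moreover have "y \<in> attractor" if y: "\<alpha> i < y" "y < \<beta> i" for y
  proof -
    have "eventually (\<lambda>n. ?u n < y \<and> y < ?v n) sequentially"
      using order_tendstoD[OF \<alpha>(1)[OF i]] order_tendstoD[OF \<beta>(1)[OF i]] y eventually_conj by blast
    then obtain n where "?u n < y \<and> y < ?v n"
      using eventually_happens'[OF sequentially_bot] by blast
    then show ?thesis using iter[of n] by auto
  qed
  ultimately show ?thesis
    unfolding block_def by (metis atLeastAtMost_iff less_eq_real_def subsetI)
qed

lemma core_subset_attractor: "i < m \<Longrightarrow> {c' i..d' i} \<subseteq> attractor"
proof (induction i)
  case 0
  show ?case by (rule first_core_subset_attractor)
next
  case (Suc i)
  have "{c' (Suc i)..d' (Suc i)} \<subseteq> fiber_map F 4 ` {c' i..d' i}"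
    using order[of i] Suc.prems step_over[OF Suc.prems] by (subst fiber_map_Icc) auto
  also have "\<dots> \<subseteq> attractor"
    using fiber_map_attractor[of 4] Suc by auto
  finally show ?case .
qed

lemma attractor_eq_blocks: "attractor = blocks"
  using attractor_subset_blocks block_subset_attractor core_subset_attractor
  unfolding blocks_def by blast

lemma fiber_map_1_attractor: "fiber_map F 1 ` attractor = attractor"
  unfolding attractor_eq_blocks blocks_def image_UN using block_fixed by auto

proposition closure_coding_graph_eq_omega_limit:
  assumes "disjunctive \<theta>" "x \<in> {0..1}"
  shows "closure (coding_graph F) = omega_limit F (\<theta>, x)"
proof -
  have "fiber_map F 2 ` {0..1} \<subseteq> {c 0..d 0}" by (rule into_first) simp
  also have "\<dots> \<subseteq> block 0" using m \<alpha>(3)[of 0] \<beta>(2)[of 0] by (auto simp: block_def)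
  also have "\<dots> \<subseteq> attractor"
    unfolding attractor_eq_blocks blocks_def using m by (intro UN_upper) auto
  finally show ?thesis using omega_limit_disjunctive[OF assms, of 2] by simp
qed

text \<open>
  The sequences over which the fibres are computed. The condition concerns the remote past, as the
  fibre over a sequence depends on its past only.
\<close>

definition past_eventually_one :: "(int \<Rightarrow> nat) set" where
  "past_eventually_one = {\<theta> \<in> \<Sigma>4. \<exists>N::nat. \<forall>k < - int N. \<theta> k = 1}"

lemma dense_past_eventually_one: "dense_in_\<Sigma>4 past_eventually_one"
  unfolding dense_in_\<Sigma>4_def
proof (intro conjI subsetI)
  fix \<theta> assume \<theta>: "\<theta> \<in> \<Sigma>4"
  show "\<theta> \<in> closure past_eventually_one"
  proof (rule closure_iff_nhds_not_empty[THEN iffD2], intro allI impI)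
    fix A U assume "U \<subseteq> A" "open U" "\<theta> \<in> U"
    then obtain N where N: "\<And>\<theta>'. agree_on_window N \<theta> \<theta>' \<Longrightarrow> \<theta>' \<in> U"
      using open_contains_window by metis
    define \<theta>' where "\<theta>' k = (if k < - int N then 1 else \<theta> k)" for k
    have "\<theta>' \<in> U" by (rule N) (simp add: agree_on_window_def \<theta>'_def)
    moreover have "\<theta>' \<in> past_eventually_one"
      using \<theta> by (auto simp: past_eventually_one_def \<Sigma>4_def \<theta>'_def)
    ultimately show "past_eventually_one \<inter> A \<noteq> {}" using \<open>U \<subseteq> A\<close> by blast
  qed
qed (auto simp: past_eventually_one_def)

text \<open>
  The first fibre map sends the attractor onto itself, so the decreasing images of the attractor
  become constant once only the symbol 1 is left in the past.
\<close>

lemma bc_attractor_past_eventually_one: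
  assumes \<theta>: "\<theta> \<in> \<Sigma>4" and N: "\<And>k. k < - int N \<Longrightarrow> \<theta> k = 1"
  shows "(\<Inter>n. bc \<theta> n ` attractor) = bc \<theta> N ` attractor"
proof -
  have stable: "bc \<theta> (N + k) ` attractor = bc \<theta> N ` attractor" for k
  proof (induction k)
    case (Suc k)
    have "\<theta> (- int (Suc (N + k))) = 1" by (rule N) simp
    then have "bc \<theta> (N + Suc k) ` attractor = bc \<theta> (N + k) ` (fiber_map F 1 ` attractor)"
      by (simp add: image_comp)
    then show ?case using Suc fiber_map_1_attractor by simp
  qed simp
  have "bc \<theta> N ` attractor \<subseteq> bc \<theta> n ` attractor" for n
    using stable[of n] bc_attractor_antimono[OF \<theta>, of n "N + n"] by simp
  then show ?thesis by blast
qed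

lemma bc_mono:
  assumes \<theta>: "\<theta> \<in> \<Sigma>4"
  shows "strict_mono_on {0..1} (bc \<theta> n)"
proof (induction n)
  case (Suc n)
  have j: "\<theta> (- int (Suc n)) \<in> {1..4}" using \<theta> unfolding \<Sigma>4_def by blast
  show ?case
    using increasing[OF j] fiber_map_in[OF j] Suc unfolding strict_mono_on_def by simp
qed (simp add: strict_mono_on_def)

lemma bc_block:
  assumes \<theta>: "\<theta> \<in> \<Sigma>4" and i: "i < m"
  shows "bc \<theta> n ` block i = {bc \<theta> n (\<alpha> i)..bc \<theta> n (\<beta> i)}"
proof (rule subset_antisym)
  have le: "bc \<theta> n x \<le> bc \<theta> n y" if "0 \<le> x" "x \<le> y" "y \<le> 1" for x y
    using bc_mono[OF \<theta>, of n] that by (simp add: strict_mono_on_leD)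
  show "bc \<theta> n ` block i \<subseteq> {bc \<theta> n (\<alpha> i)..bc \<theta> n (\<beta> i)}"
    using le \<alpha>\<beta>[OF i] by (auto simp: block_def)
  have "continuous_on {\<alpha> i..\<beta> i} (bc \<theta> n)"
    using bc_cont[OF \<theta>] by (rule continuous_on_subset) (use \<alpha>\<beta>[OF i] in auto)
  then show "{bc \<theta> n (\<alpha> i)..bc \<theta> n (\<beta> i)} \<subseteq> bc \<theta> n ` block i"
    using IVT'[of "bc \<theta> n" "\<alpha> i" _ "\<beta> i"] \<alpha>\<beta>[OF i] unfolding block_def by fastforce
qed

lemma union_of_intervals_bc_attractor:
  assumes \<theta>: "\<theta> \<in> \<Sigma>4"
  shows "union_of_intervals m (bc \<theta> n ` attractor)"
proof -
  let ?I = "\<lambda>i. bc \<theta> n ` block i"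
  have disj: "?I i \<inter> ?I j = {}" if "i < m" "j < m" "i \<noteq> j" for i j
    using inj_on_image_Int[OF bc_inj[OF \<theta>, of n] block_subset[OF that(1)] block_subset[OF that(2)]]
      block_disjoint[OF that] by simp
  have ne: "?I i \<noteq> {}" if "i < m" for i
    using \<alpha>\<beta>[OF that] by (auto simp: block_def)
  have "inj_on ?I {..<m}"
    by (rule inj_onI) (metis disj ne inf.idem lessThan_iff)
  then have "card (?I ` {..<m}) = m" by (simp add: card_image)
  moreover have "disjoint (?I ` {..<m})"
    using disj by (fastforce simp: disjoint_def)
  moreover have "\<exists>u v. u < v \<and> ?I i = {u..v}" if "i < m" for i
    using bc_block[OF \<theta> that] bc_mono[OF \<theta>, of n] \<alpha>\<beta>[OF that]
    by (intro exI[of _ "bc \<theta> n (\<alpha> i)"] exI[of _ "bc \<theta> n (\<beta> i)"]) (auto simp: strict_mono_on_def)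
  moreover have "bc \<theta> n ` attractor = \<Union>(?I ` {..<m})"
    by (auto simp: attractor_eq_blocks blocks_def)
  ultimately show ?thesis
    unfolding union_of_intervals_def by (intro exI[of _ "?I ` {..<m}"]) auto
qed

proposition fibre_closure_coding_graph:
  assumes "\<theta> \<in> past_eventually_one"
  shows "\<exists>A. union_of_intervals m A \<and> ({\<theta>} \<times> {0..1}) \<inter> closure (coding_graph F) = {\<theta>} \<times> A"
proof -
  obtain N :: nat where \<theta>: "\<theta> \<in> \<Sigma>4" and N: "\<And>k. k < - int N \<Longrightarrow> \<theta> k = 1"
    using assms by (auto simp: past_eventually_one_def)
  have "y \<in> {0..1} \<and> (\<theta>, y) \<in> closure (coding_graph F) \<longleftrightarrow> y \<in> bc \<theta> N ` attractor" for y
  proof -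
    have "(\<forall>n. y \<in> bc \<theta> n ` attractor) \<longleftrightarrow> y \<in> (\<Inter>n. bc \<theta> n ` attractor)"
      by blast
    also have "\<dots> \<longleftrightarrow> y \<in> bc \<theta> N ` attractor"
      by (simp only: bc_attractor_past_eventually_one[OF \<theta> N])
    finally have "(\<forall>n. y \<in> bc \<theta> n ` attractor) \<longleftrightarrow> y \<in> bc \<theta> N ` attractor" .
    moreover have "bc \<theta> N ` attractor \<subseteq> {0..1}"
      using bc_image[OF \<theta>, of N] attractor_subset by (meson image_mono subset_trans)
    ultimately show ?thesis unfolding closure_coding_graph_iff using \<theta> by blast
  qed
  then have "({\<theta>} \<times> {0..1}) \<inter> closure (coding_graph F) = {\<theta>} \<times> bc \<theta> N ` attractor"
    by blast
  then show ?thesis using union_of_intervals_bc_attractor[OF \<theta>, of N] by blast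
qed

end

section \<open>Fibre maps close to given ones\<close>

lemma C1_maps_mean_value:
  assumes f: "f \<in> C1_maps" and xy: "0 \<le> x" "x < y" "y \<le> 1"
  shows "\<exists>z\<in>{0..1}. f y - f x = deriv01 f z * (y - x)"
proof -
  have "(f has_derivative (\<lambda>h. deriv01 f z * h)) (at z within {x..y})" if "x \<le> z" "z \<le> y" for z
  proof -
    have "f differentiable (at z within {0..1})"
      using f that xy by (auto simp: C1_maps_def differentiable_on_def)
    then have "(f has_vector_derivative deriv01 f z) (at z within {0..1})"
      unfolding deriv01_def by (simp add: vector_derivative_works)
    then have "(f has_vector_derivative deriv01 f z) (at z within {x..y})"
      by (rule has_vector_derivative_within_subset) (use xy in auto)
    then show ?thesis by (simp add: has_vector_derivative_def mult.commute)
  qed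
  from mvt_simple[OF xy(2) this] obtain z where
    "z \<in> {x<..<y}" "f y - f x = deriv01 f z * (y - x)" by auto
  then show ?thesis using xy by (intro bexI[of _ z]) auto
qed

lemma C1_maps_Lipschitz:
  assumes f: "f \<in> C1_maps" and L: "\<And>z. z \<in> {0..1} \<Longrightarrow> \<bar>deriv01 f z\<bar> \<le> L"
    and "x \<in> {0..1}" "y \<in> {0..1}"
  shows "\<bar>f x - f y\<bar> \<le> L * \<bar>x - y\<bar>"
proof -
  have *: "\<bar>f v - f u\<bar> \<le> L * \<bar>v - u\<bar>" if "0 \<le> u" "u < v" "v \<le> 1" for u v
    using C1_maps_mean_value[OF f that] L by (auto simp: abs_mult intro!: mult_right_mono)
  show ?thesis
    using *[of x y] *[of y x] assms(3,4) by (cases x y rule: linorder_cases) (auto simp: abs_minus_commute)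
qed

lemma C1_maps_strict_mono:
  assumes f: "f \<in> C1_maps" and pos: "\<And>z. z \<in> {0..1} \<Longrightarrow> 0 < deriv01 f z"
  shows "strict_mono_on {0..1} f"
proof (rule strict_mono_onI)
  fix x y :: real assume xy: "x \<in> {0..1}" "y \<in> {0..1}" "x < y"
  then obtain z where "z \<in> {0..1}" "f y - f x = deriv01 f z * (y - x)"
    using C1_maps_mean_value[OF f, of x y] by auto
  then show "f x < f y" using pos[of z] xy(3) by (smt (verit) mult_pos_pos)
qed

lemma restrict_in_C1_maps:
  assumes der: "\<And>x. (g has_real_derivative g' x) (at x)"
    and cont: "continuous_on {0..1} g'" and into: "g ` {0..1} \<subseteq> {0..1}"
  shows "restrict g {0..1} \<in> C1_maps"
    and "x \<in> {0..1} \<Longrightarrow> deriv01 (restrict g {0..1}) x = g' x"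
proof -
  have vd: "(restrict g {0..1} has_vector_derivative g' x) (at x within {0..1})" if "x \<in> {0..1}" for x
  proof -
    have "(g has_vector_derivative g' x) (at x within {0..1})"
      using has_field_derivative_at_within[OF der]
      by (simp add: has_real_derivative_iff_has_vector_derivative)
    then show ?thesis
      by (rule has_vector_derivative_transform[rotated 2]) (use that in auto)
  qed
  show d: "deriv01 (restrict g {0..1}) x = g' x" if "x \<in> {0..1}" for x
    unfolding deriv01_def using vector_derivative_within_closed_interval[OF _ that vd[OF that]] by simp
  have "restrict g {0..1} differentiable_on {0..1}"
    unfolding differentiable_on_def using vd differentiableI_vector by blast
  moreover have "continuous_on {0..1} (deriv01 (restrict g {0..1}))"
    by (rule continuous_on_eq[OF cont]) (use d in auto)
  ultimately show "restrict g {0..1} \<in> C1_maps"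
    using into by (auto simp: C1_maps_def)
qed

lemma dist_skew_bounds:
  assumes F: "F \<in> step_skew_products" and G: "G \<in> step_skew_products"
    and i: "i \<in> {1..4}" and x: "x \<in> {0..1}"
  shows "\<bar>fiber_map F i x - fiber_map G i x\<bar> \<le> dist_skew F G"
    and "\<bar>deriv01 (fiber_map F i) x - deriv01 (fiber_map G i) x\<bar> \<le> dist_skew F G"
proof -
  note C = fiber_map_in_C1_maps[OF F i] fiber_map_in_C1_maps[OF G i]
  have cont: "continuous_on {0..1} (deriv01 u)" if "u \<in> C1_maps" for u
    using that by (simp add: C1_maps_def)
  have le: "dist_C1 (fiber_map F i) (fiber_map G i) \<le> dist_skew F G"
    unfolding dist_skew_def using F G i by (auto intro!: Max_ge)
  show "\<bar>fiber_map F i x - fiber_map G i x\<bar> \<le> dist_skew F G"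
    using dist_C1(1)[OF C C(1) x] le by linarith
  show "\<bar>deriv01 (fiber_map F i) x - deriv01 (fiber_map G i) x\<bar> \<le> dist_skew F G"
    using sup_abs_diff(1)[OF cont[OF C(1)] cont[OF C(2)] cont[OF C(1)] x] le
    unfolding dist_C1_def by linarith
qed

section \<open>Building the fibre maps\<close>

text \<open>
  The identity plus a small multiple of a polynomial that is negative on \<open>L\<close> and positive on \<open>R\<close>.
  Such a polynomial approximates the difference of the distances to the two sets. Adding the end
  point 1 to \<open>L\<close> and 0 to \<open>R\<close> makes the map send \<open>{0..1}\<close> into itself.
\<close>

lemma exists_pushing_map:
  fixes L R :: "real set"
  assumes L: "closed L" "L \<subseteq> {0<..1}" and R: "closed R" "R \<subseteq> {0..<1}" and disj: "L \<inter> R = {}"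
  obtains g g' :: "real \<Rightarrow> real" and \<delta> :: real where
    "\<And>x. (g has_real_derivative g' x) (at x)" "continuous_on {0..1} g'" "g ` {0..1} \<subseteq> {0..1}"
    "\<And>x. x \<in> {0..1} \<Longrightarrow> 1/2 \<le> g' x" "\<delta> > 0"
    "\<And>x. x \<in> L \<Longrightarrow> g x \<le> x - \<delta>" "\<And>x. x \<in> R \<Longrightarrow> x + \<delta> \<le> g x"
proof -
  let ?L = "insert 1 L" and ?R = "insert 0 R"
  define \<phi> where "\<phi> x = infdist x ?L - infdist x ?R" for x :: real
  have cl: "closed ?L" "closed ?R" using L R by auto
  have disj': "?L \<inter> ?R = {}" using L R disj by auto
  have neg: "\<phi> x < 0" if "x \<in> ?L" for x
    using infdist_pos_not_in_closed[OF cl(2), of x] disj' that unfolding \<phi>_def by fastforce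
  have pos: "\<phi> x > 0" if "x \<in> ?R" for x
    using infdist_pos_not_in_closed[OF cl(1), of x] disj' that unfolding \<phi>_def by fastforce
  have cont\<phi>: "continuous_on S \<phi>" for S unfolding \<phi>_def by (intro continuous_intros)
  have comp: "compact (?L \<union> ?R)"
  proof -
    have "?L \<union> ?R \<subseteq> {0..1}" using L R by auto
    then show ?thesis using cl by (metis closed_Un compact_Icc compact_Int_closed inf.absorb_iff2)
  qed
  have "\<exists>x0\<in>?L \<union> ?R. \<forall>x\<in>?L \<union> ?R. \<bar>\<phi> x0\<bar> \<le> \<bar>\<phi> x\<bar>"
    by (rule continuous_attains_inf[OF comp]) (auto intro!: continuous_intros cont\<phi>)
  then obtain x0 where x0: "x0 \<in> ?L \<union> ?R" "\<And>x. x \<in> ?L \<union> ?R \<Longrightarrow> \<bar>\<phi> x0\<bar> \<le> \<bar>\<phi> x\<bar>"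
    by meson
  define \<eta> where "\<eta> = \<bar>\<phi> x0\<bar>"
  have \<eta>: "\<eta> > 0" using x0(1) neg pos unfolding \<eta>_def by force
  obtain P where P: "real_polynomial_function P" "\<And>x. x \<in> {0..1} \<Longrightarrow> \<bar>\<phi> x - P x\<bar> < \<eta> / 2"
    using Stone_Weierstrass_real_polynomial_function[OF compact_Icc cont\<phi>, of "\<eta> / 2" 0 1] \<eta> by auto
  obtain P' where P': "real_polynomial_function P'" "\<And>x. (P has_real_derivative P' x) (at x)"
    using has_real_derivative_polynomial_function[OF P(1)] by blast
  have contP': "continuous_on {0..1} P'"
    using continuous_real_polymonial_function[OF P'(1)] by (simp add: continuous_at_imp_continuous_on)
  then have "bounded (P' ` {0..1})"
    using compact_continuous_image compact_Icc compact_imp_bounded by blast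
  then obtain B where B: "B > 0" "\<And>x. x \<in> {0..1} \<Longrightarrow> \<bar>P' x\<bar> \<le> B"
    unfolding bounded_pos by auto
  \<comment> \<open>This multiple of the polynomial has derivative at most 1/2 in absolute value on \<open>{0..1}\<close>.\<close>
  define \<epsilon> where "\<epsilon> = 1 / (2 * B)"
  define g where "g x = x + \<epsilon> * P x" for x
  have \<epsilon>: "\<epsilon> > 0" "\<epsilon> * B = 1/2" using B(1) by (auto simp: \<epsilon>_def)
  have PL: "P x \<le> - (\<eta> / 2)" if "x \<in> ?L" for x
  proof -
    have "x \<in> {0..1}" using that L(2) by auto
    then have "P x - \<phi> x < \<eta> / 2" using P(2)[of x] by linarith
    moreover have "\<eta> \<le> - \<phi> x" using x0(2)[of x] neg[OF that] that unfolding \<eta>_def by auto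
    ultimately show ?thesis by linarith
  qed
  have PR: "P x \<ge> \<eta> / 2" if "x \<in> ?R" for x
  proof -
    have "x \<in> {0..1}" using that R(2) by auto
    then have "\<phi> x - P x < \<eta> / 2" using P(2)[of x] by linarith
    moreover have "\<eta> \<le> \<phi> x" using x0(2)[of x] pos[OF that] that unfolding \<eta>_def by auto
    ultimately show ?thesis by linarith
  qed
  have der: "(g has_real_derivative 1 + \<epsilon> * P' x) (at x)" for x
    unfolding g_def by (auto intro!: derivative_eq_intros P'(2))
  have der_ge: "1/2 \<le> 1 + \<epsilon> * P' x" if "x \<in> {0..1}" for x
  proof -
    have "\<epsilon> * (- P' x) \<le> \<epsilon> * B" using B(2)[OF that] \<epsilon>(1) by (intro mult_left_mono) auto
    then show ?thesis using \<epsilon>(2) by simp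
  qed
  have mono: "g x \<le> g y" if "0 \<le> x" "x \<le> y" "y \<le> 1" for x y
  proof (rule DERIV_nonneg_imp_nondecreasing[OF that(2)])
    fix z assume "x \<le> z" "z \<le> y"
    then have "0 \<le> 1 + \<epsilon> * P' z" using der_ge[of z] that by auto
    then show "\<exists>D. (g has_real_derivative D) (at z) \<and> 0 \<le> D" using der by blast
  qed
  have gL: "g x \<le> x - \<epsilon> * \<eta> / 2" if "x \<in> ?L" for x
    using mult_left_mono[OF PL[OF that], of \<epsilon>] \<epsilon>(1) by (simp add: g_def)
  have gR: "x + \<epsilon> * \<eta> / 2 \<le> g x" if "x \<in> ?R" for x
    using mult_left_mono[OF PR[OF that], of \<epsilon>] \<epsilon>(1) by (simp add: g_def)
  have \<delta>: "\<epsilon> * \<eta> / 2 > 0" using \<epsilon>(1) \<eta> by simp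
  show thesis
  proof (rule that[OF der _ _ der_ge \<delta>])
    show "continuous_on {0..1} (\<lambda>x. 1 + \<epsilon> * P' x)" by (intro continuous_intros contP')
    have ends: "0 \<le> g 0" "g 1 \<le> 1" using gR[of 0] gL[of 1] \<delta> by auto
    show "g ` {0..1} \<subseteq> {0..1}"
    proof (rule image_subsetI)
      show "g x \<in> {0..1}" if "x \<in> {0..1}" for x
        using ends mono[of 0 x] mono[of x 1] that by auto
    qed
  qed (use gL gR in auto)
qed

text \<open>
  The fourth fibre map is to be affine with slope 1/10, here \<open>x \<mapsto> x / 10 + k\<close>. With fixed point
  1/20 it moves an interval near \<open>1/20 + u / 10 ^ i\<close> to one near \<open>1/20 + u / 10 ^ (i + 1)\<close>. So the
  blocks are placed at nearly the same coordinates \<open>u\<close> in successive scales, and the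
  inclusions are made strict by letting the core shrink and the other intervals grow with \<open>i\<close>
  by multiples of a small number \<open>t\<close>. The last block must contain its own image; it is
  extended to the left across the fixed point 1/20.

  For a single block, which has to contain the images of the two contractions, the fixed point lies
  inside that block instead.
\<close>

lemma exists_block_geometry:
  assumes m: "m \<ge> (1::nat)"
  obtains a c c' d' d b :: "nat \<Rightarrow> real" and k e :: real where
    "\<And>i. i < m \<Longrightarrow> 0 < a i \<and> a i < c i \<and> c i < c' i \<and> c' i < d' i \<and> d' i < d i \<and> d i < b i \<and> b i < 1"
    "\<And>i j. i < j \<Longrightarrow> j < m \<Longrightarrow> b j < a i"
    "c 0 \<le> 19/100" "c' 0 = 52/100" "d' 0 = 73/100" "91/100 \<le> d 0"
    "0 \<le> k" "k \<le> 9/10" "e > 0"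
    "\<And>i. i < m \<Longrightarrow> c (min (Suc i) (m - 1)) + e \<le> a i / 10 + k"
    "\<And>i. i < m \<Longrightarrow> b i / 10 + k + e \<le> d (min (Suc i) (m - 1))"
    "\<And>i. Suc i < m \<Longrightarrow> c' i / 10 + k + e \<le> c' (Suc i)"
    "\<And>i. Suc i < m \<Longrightarrow> d' (Suc i) + e \<le> d' i / 10 + k"
proof (cases "m = 1")
  case True
  show thesis
    by (rule that[of "\<lambda>_. 18/100" "\<lambda>_. 19/100" "\<lambda>_. 52/100" "\<lambda>_. 73/100" "\<lambda>_. 91/100" "\<lambda>_. 92/100" "1/2" "1/1000"])
      (use True in auto)
next
  case False
  with m have m2: "m \<ge> 2" by simp
  define t where "t = 1 / (100 * real m)"
  define s where "s i = (1 / 10 :: real) ^ i" for i :: nat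
  define c where "c i = 1/20 + s i * (if i = m - 1 then - 1/5 else 14/100 - 2 * real i * t)" for i
  define a where "a i = 1/20 + s i * (if i = m - 1 then - 2/5 else 14/100 - (2 * real i + 1) * t)" for i
  define c' where "c' i = 1/20 + s i * (47/100 + real i * t)" for i
  define d' where "d' i = 1/20 + s i * (68/100 - real i * t)" for i
  define d where "d i = 1/20 + s i * (86/100 + 2 * real i * t)" for i
  define b where "b i = 1/20 + s i * (86/100 + (2 * real i + 1) * t)" for i
  have t: "0 < t" "t \<le> 1/200" using m2 by (auto simp: t_def field_simps)
  have it: "0 \<le> real i * t" "real i * t + t \<le> 1/100" if "i < m" for i
  proof -
    have "real i * t + t = (real i + 1) * t" by (simp add: algebra_simps)
    also have "\<dots> \<le> real m * t" using that t(1) by (intro mult_right_mono) auto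
    finally show "real i * t + t \<le> 1/100" using m2 by (simp add: t_def)
  qed (use t in auto)
  have s0: "0 < s i" and s1: "s i \<le> 1" for i by (auto simp: s_def power_le_one)
  have sSuc: "s (Suc i) = s i / 10" for i by (simp add: s_def)
  have sle: "s j \<le> s i" if "i \<le> j" for i j
    unfolding s_def using that by (intro power_decreasing) auto
  \<comment> \<open>The slack \<open>s m * t\<close> is a common lower bound for the gaps in all scales.\<close>
  have e_le: "s m * t \<le> s i * u" if "i \<le> m" "t \<le> u" for i u
    using sle[OF that(1)] that(2) t(1) s0[of i] by (intro mult_mono) auto
  show thesis
  proof (rule that[of a c c' d' d b "9/200" "s m * t"])
    fix i assume i: "i < m"
    note bnd = it[OF i] t s0[of i] s1[of i]
    have less: "1/20 + s i * u < 1/20 + s i * v" if "u < v" for u v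
      using that s0[of i] by simp
    have "0 < a i"
    proof (cases "i = m - 1")
      case True
      then have "s i \<le> s 1" using m2 by (intro sle) auto
      then show ?thesis using True by (simp add: a_def s_def)
    next
      case False
      have "0 \<le> s i * (14/100 - (2 * real i + 1) * t)"
        using bnd by (intro mult_nonneg_nonneg) (auto simp: algebra_simps)
      then show ?thesis using False by (simp add: a_def)
    qed
    moreover have "b i < 1"
    proof -
      have "s i * (86/100 + (2 * real i + 1) * t) \<le> 1 * (88/100)"
        using bnd by (intro mult_mono) (auto simp: algebra_simps)
      then show ?thesis by (simp add: b_def)
    qed
    moreover have "a i < c i" "c i < c' i" "c' i < d' i" "d' i < d i" "d i < b i"
    proof -
      define q where "q = real i * t"
      have q: "2 * real i * t = 2 * q" "(2 * real i + 1) * t = 2 * q + t" "real i * t = q"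
        by (auto simp: q_def algebra_simps)
      have "0 \<le> q" "q + t \<le> 1/100" using it[OF i] by (auto simp: q_def)
      then show "a i < c i" "c i < c' i" "c' i < d' i" "d' i < d i" "d i < b i"
        unfolding a_def c_def c'_def d'_def d_def b_def q using t
        by (intro less; simp)+
    qed
    ultimately show "0 < a i \<and> a i < c i \<and> c i < c' i \<and> c' i < d' i \<and> d' i < d i \<and> d i < b i \<and> b i < 1"
      by blast
    show "c (min (Suc i) (m - 1)) + s m * t \<le> a i / 10 + 9/200"
    proof (cases "i = m - 1")
      case True
      then have "min (Suc i) (m - 1) = i" "c i = 1/20 - s i / 5" "a i = 1/20 - s i * 2 / 5"
        using i by (auto simp: c_def a_def)
      moreover have "s m * t \<le> s i * (16/100)" using i t by (intro e_le) auto
      ultimately show ?thesis by (simp add: field_simps)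
    next
      case False
      then have mi: "min (Suc i) (m - 1) = Suc i" using i by simp
      have "s m * t \<le> s (Suc i) * t" using e_le[of "Suc i" t] i by simp
      moreover have "s (Suc i) * t \<le> s (Suc i) * (34/100 - (2 * real i + 1) * t)"
        using s0[of "Suc i"] bnd by (intro mult_left_mono) (auto simp: algebra_simps)
      ultimately show ?thesis unfolding mi c_def a_def using False
        by (auto simp: sSuc field_simps)
    qed
    show "b i / 10 + 9/200 + s m * t \<le> d (min (Suc i) (m - 1))"
    proof (cases "i = m - 1")
      case True
      then have mi: "min (Suc i) (m - 1) = i" using i by simp
      have "s m * t \<le> s i * (86/100 + 2 * real i * t - (86/100 + (2 * real i + 1) * t) / 10)"
      proof (rule e_le)
        define q where "q = real i * t"
        have q: "2 * real i * t = 2 * q" "(2 * real i + 1) * t = 2 * q + t"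
          by (auto simp: q_def algebra_simps)
        have "0 \<le> q" "q + t \<le> 1/100" using it[OF i] by (auto simp: q_def)
        then show "t \<le> 86/100 + 2 * real i * t - (86/100 + (2 * real i + 1) * t) / 10"
          unfolding q using t by (simp add: field_simps)
      qed (use i in simp)
      then show ?thesis unfolding mi d_def b_def by (simp add: field_simps)
    next
      case False
      then have mi: "min (Suc i) (m - 1) = Suc i" using i by simp
      have "s m * t \<le> s (Suc i) * t" using e_le[of "Suc i" t] i by simp
      then show ?thesis unfolding mi d_def b_def by (simp add: sSuc field_simps)
    qed
  next
    fix i assume i: "Suc i < m"
    have "s m * t \<le> s (Suc i) * t" using e_le[of "Suc i" t] i by simp
    then show "c' i / 10 + 9/200 + s m * t \<le> c' (Suc i)" "d' (Suc i) + s m * t \<le> d' i / 10 + 9/200"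
      unfolding c'_def d'_def by (simp_all add: sSuc field_simps)
  next
    fix i j assume ij: "i < j" "j < m"
    have "s j * (86/100 + (2 * real j + 1) * t) \<le> s j * (88/100)"
      using s0[of j] it[OF ij(2)] t by (intro mult_left_mono) (auto simp: algebra_simps)
    also have "\<dots> \<le> s (Suc i) * (88/100)" using sle[of "Suc i" j] ij by simp
    also have "\<dots> < s i * (12/100)" using s0[of i] by (simp add: sSuc)
    also have "\<dots> \<le> s i * (14/100 - (2 * real i + 1) * t)"
      using s0[of i] it[of i] t ij by (intro mult_left_mono) (auto simp: algebra_simps)
    finally have "s j * (86/100 + (2 * real j + 1) * t) < s i * (14/100 - (2 * real i + 1) * t)" .
    moreover have "i \<noteq> m - 1" using ij by simp
    ultimately show "b j < a i" unfolding a_def b_def by simp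
  qed (use m2 t s0[of m] in \<open>auto simp: c_def c'_def d'_def d_def s_def\<close>)
qed

text \<open>
  The contractions \<open>6/10 * x + 2/10\<close> and \<open>6/10 * x + 3/10\<close> have the fixed points 1/2 and 3/4. The
  first core \<open>{52/100..73/100}\<close> lies strictly between them and has length more than 1/6, so its
  two images cover it and overlap. They map \<open>{0..1}\<close> into \<open>{2/10..9/10}\<close>, inside the first block.
  All inequalities hold with a slack of at least \<open>\<epsilon>\<close>, which is also the radius of the ball.
\<close>

lemma exists_robust_block_system:
  assumes m: "m \<ge> 1"
  shows "\<exists>F0 \<epsilon> a c c' d' d b. F0 \<in> step_skew_products \<and> \<epsilon> > 0 \<and>
    (\<forall>F\<in>step_skew_products. dist_skew F0 F < \<epsilon> \<longrightarrow> block_system F m a c c' d' d b)"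
proof -
  obtain a c c' d' d b k e where
    ord: "\<And>i. i < m \<Longrightarrow> 0 < a i \<and> a i < c i \<and> c i < c' i \<and> c' i < d' i \<and> d' i < d i \<and> d i < b i \<and> b i < 1"
    and sep: "\<And>i j. i < j \<Longrightarrow> j < m \<Longrightarrow> b j < a i"
    and first: "c 0 \<le> 19/100" "c' 0 = 52/100" "d' 0 = 73/100" "91/100 \<le> d 0"
    and k: "0 \<le> k" "k \<le> 9/10" and e: "e > (0::real)"
    and step: "\<And>i. i < m \<Longrightarrow> c (min (Suc i) (m - 1)) + e \<le> a i / 10 + k"
    "\<And>i. i < m \<Longrightarrow> b i / 10 + k + e \<le> d (min (Suc i) (m - 1))"
    "\<And>i. Suc i < m \<Longrightarrow> c' i / 10 + k + e \<le> c' (Suc i)"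
    "\<And>i. Suc i < m \<Longrightarrow> d' (Suc i) + e \<le> d' i / 10 + k"
    by (rule exists_block_geometry[OF m]) (rule that)
  define L where "L = (\<Union>i<m. insert (b i) {c i..c' i})"
  define R where "R = (\<Union>i<m. insert (a i) {d' i..d i})"
  have "closed L" "closed R" unfolding L_def R_def by (auto intro!: closed_UN closed_insert)
  moreover have "L \<subseteq> {0<..1}" "R \<subseteq> {0..<1}"
    using ord unfolding L_def R_def by (fastforce dest: ord)+
  moreover have "L \<inter> R = {}"
  proof (rule ccontr)
    assume "L \<inter> R \<noteq> {}"
    then obtain x where xL: "x \<in> L" and xR: "x \<in> R" by blast
    obtain i where i: "i < m" "x = b i \<or> c i \<le> x \<and> x \<le> c' i" using xL by (auto simp: L_def)
    obtain j where j: "j < m" "x = a j \<or> d' j \<le> x \<and> x \<le> d j" using xR by (auto simp: R_def)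
    note ij = i(1) j(1) and x = i(2) j(2)
    consider "i = j" | "i < j" | "j < i" by linarith
    then show False
      using x ord[OF ij(1)] ord[OF ij(2)] sep[of i j] sep[of j i] ij by cases auto
  qed
  ultimately obtain g g' \<delta> where
    g: "\<And>x. (g has_real_derivative g' x) (at x)" "continuous_on {0..1} g'" "g ` {0..1} \<subseteq> {0..1}"
    and g_ge: "\<And>x. x \<in> {0..1} \<Longrightarrow> 1/2 \<le> g' x" and \<delta>: "\<delta> > (0::real)"
    and gL: "\<And>x. x \<in> L \<Longrightarrow> g x \<le> x - \<delta>" and gR: "\<And>x. x \<in> R \<Longrightarrow> x + \<delta> \<le> g x"
    using exists_pushing_map[of L R] by metis
  define h where "h j = (if j = 1 then g else if j = 2 then (\<lambda>x. 6/10 * x + 2/10)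
    else if j = 3 then (\<lambda>x. 6/10 * x + 3/10) else (\<lambda>x. x / 10 + k))" for j :: nat
  define h' where "h' j = (if j = 1 then g' else if j = 2 \<or> j = 3 then (\<lambda>_. 6/10) else (\<lambda>_. 1/10))" for j :: nat
  have h: "(h j has_real_derivative h' j x) (at x)" "continuous_on {0..1} (h' j)" "h j ` {0..1} \<subseteq> {0..1}" for j x
    using g k by (auto simp: h_def h'_def intro!: derivative_eq_intros continuous_intros)
  define F0 where "F0 = step_skew (\<lambda>j\<in>{1..4}. restrict (h j) {0..1})"
  have hC: "(\<lambda>j\<in>{1..4}. restrict (h j) {0..1}) \<in> {1..4} \<rightarrow>\<^sub>E C1_maps"
    using restrict_in_C1_maps(1)[OF h] by auto
  then have F0: "F0 \<in> step_skew_products" by (auto simp: F0_def step_skew_products_def)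
  have fib: "fiber_map F0 j = restrict (h j) {0..1}" if "j \<in> {1..4}" for j
    unfolding F0_def using fiber_map_step_skew[OF hC that] that by simp
  define \<epsilon> where "\<epsilon> = min (min e \<delta>) (1/1000)"
  have \<epsilon>: "\<epsilon> > 0" "\<epsilon> \<le> e" "\<epsilon> \<le> \<delta>" "\<epsilon> \<le> 1/1000" using e \<delta> by (auto simp: \<epsilon>_def)
  have "block_system F m a c c' d' d b"
    if F: "F \<in> step_skew_products" and near: "dist_skew F0 F < \<epsilon>" for F
  proof -
    let ?f = "fiber_map F"
    have val: "\<bar>h j x - ?f j x\<bar> < \<epsilon>" and der: "\<bar>h' j x - deriv01 (?f j) x\<bar> < \<epsilon>"
      if "j \<in> {1..4}" "x \<in> {0..1}" for j x
      using dist_skew_bounds[OF F0 F that] near fib[OF that(1)] restrict_in_C1_maps(2)[OF h that(2)] that(2)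
      by auto
    have C: "?f j \<in> C1_maps" if "j \<in> {1..4}" for j using fiber_map_in_C1_maps[OF F that] .
    have v1: "\<bar>g x - ?f 1 x\<bar> < \<epsilon>" if "x \<in> {0..1}" for x
      using val[of 1 x] that by (simp add: h_def)
    have v2: "\<bar>6/10 * x + 2/10 - ?f 2 x\<bar> < \<epsilon>" if "x \<in> {0..1}" for x
      using val[of 2 x] that by (simp add: h_def)
    have v3: "\<bar>6/10 * x + 3/10 - ?f 3 x\<bar> < \<epsilon>" if "x \<in> {0..1}" for x
      using val[of 3 x] that by (simp add: h_def)
    have v4: "\<bar>x / 10 + k - ?f 4 x\<bar> < \<epsilon>" if "x \<in> {0..1}" for x
      using val[of 4 x] that by (simp add: h_def)
    show ?thesis
    proof (unfold_locales)
      show "strict_mono_on {0..1} (?f j)" if "j \<in> {1..4}" for j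
      proof (rule C1_maps_strict_mono[OF C[OF that]])
        fix z :: real assume z: "z \<in> {0..1}"
        have "1/10 \<le> h' j z" using g_ge[OF z] by (auto simp: h'_def)
        then show "0 < deriv01 (?f j) z" using der[OF that z] \<epsilon>(4) by linarith
      qed
      show "\<bar>?f j x - ?f j y\<bar> \<le> 3/4 * \<bar>x - y\<bar>"
        if j: "j \<in> {2, 3}" and xy: "x \<in> {0..1}" "y \<in> {0..1}" for j x y
      proof (rule C1_maps_Lipschitz[OF C _ xy])
        show j': "j \<in> {1..4}" using j by auto
        show "\<bar>deriv01 (?f j) z\<bar> \<le> 3/4" if "z \<in> {0..1}" for z
          using der[OF j' that] \<epsilon>(4) j by (auto simp: h'_def)
      qed
      show "?f j ` {0..1} \<subseteq> {c 0..d 0}" if "j \<in> {2, 3}" for j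
      proof
        fix y assume "y \<in> ?f j ` {0..1}"
        then obtain x where "x \<in> {0..1}" "y = ?f j x" by blast
        then show "y \<in> {c 0..d 0}" using v2[of x] v3[of x] that first \<epsilon>(4) by auto
      qed
      show "?f 2 (c' 0) \<le> c' 0" "?f 3 (c' 0) \<le> ?f 2 (d' 0)" "d' 0 \<le> ?f 3 (d' 0)"
        using v2[of "c' 0"] v3[of "c' 0"] v2[of "d' 0"] v3[of "d' 0"] \<epsilon>(4)
        unfolding first(2,3) by auto
    next
      fix i assume i: "i < m"
      have "b i \<in> L" "a i \<in> R" using i by (auto simp: L_def R_def)
      then show "a i < ?f 1 (a i)" "?f 1 (b i) < b i"
        using gL[of "b i"] gR[of "a i"] v1[of "a i"] v1[of "b i"] ord[OF i] \<epsilon>(3) by auto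
      show "?f 1 x < x" if "x \<in> {c i..c' i}" for x
      proof -
        have "x \<in> L" using i that by (auto simp: L_def)
        then show ?thesis using gL[of x] v1[of x] ord[OF i] that \<epsilon>(3) by auto
      qed
      show "x < ?f 1 x" if "x \<in> {d' i..d i}" for x
      proof -
        have "x \<in> R" using i that by (auto simp: R_def)
        then show ?thesis using gR[of x] v1[of x] ord[OF i] that \<epsilon>(3) by auto
      qed
      show "c (min (Suc i) (m - 1)) \<le> ?f 4 (a i)" "?f 4 (b i) \<le> d (min (Suc i) (m - 1))"
        using step(1,2)[OF i] v4[of "a i"] v4[of "b i"] ord[OF i] \<epsilon>(2) by auto
      show "0 \<le> a i \<and> a i < c i \<and> c i < c' i \<and> c' i < d' i \<and> d' i < d i \<and> d i < b i \<and> b i \<le> 1"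
        using ord[OF i] by auto
    next
      fix i assume i: "Suc i < m"
      show "?f 4 (c' i) \<le> c' (Suc i)" "d' (Suc i) \<le> ?f 4 (d' i)"
        using step(3,4)[OF i] v4[of "c' i"] v4[of "d' i"] ord[of i] i \<epsilon>(2) by auto
    qed (use F m sep in auto)
  qed
  with F0 \<epsilon>(1) show ?thesis by blast
qed

theorem theorem2:
  fixes m :: nat
  assumes "m \<ge> 1"
  shows "\<exists>\<S>\<^sub>m. \<S>\<^sub>m \<noteq> {} \<and> openin skew_topology \<S>\<^sub>m \<and>
    (\<forall>F\<in>\<S>\<^sub>m.
      (\<forall>i\<in>{1..4}. inj_on (fiber_map F i) {0..1}) \<and>
      (\<forall>\<theta> x. disjunctive \<theta> \<and> x \<in> {0..1} \<longrightarrow>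
         closure (coding_graph F) = omega_limit F (\<theta>, x)) \<and>
      (\<exists>\<Gamma>. dense_in_\<Sigma>4 \<Gamma> \<and>
        (\<forall>\<theta>\<in>\<Gamma>. \<exists>A. union_of_intervals m A \<and>
           ({\<theta>} \<times> {0..1}) \<inter> closure (coding_graph F) = {\<theta>} \<times> A)))"
proof -
  interpret M: Metric_space step_skew_products dist_skew by (rule Metric_space_skew)
  obtain F0 \<epsilon> a c c' d' d b where F0: "F0 \<in> step_skew_products" "\<epsilon> > 0"
    and near: "\<And>F. F \<in> step_skew_products \<Longrightarrow> dist_skew F0 F < \<epsilon> \<Longrightarrow> block_system F m a c c' d' d b"
    using exists_robust_block_system[OF assms] by blast
  show ?thesis
  proof (intro exI[of _ "M.mball F0 \<epsilon>"] conjI ballI)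
    show "M.mball F0 \<epsilon> \<noteq> {}" using F0 M.centre_in_mball_iff by blast
    show "openin skew_topology (M.mball F0 \<epsilon>)" by (rule M.openin_mball)
    fix F assume "F \<in> M.mball F0 \<epsilon>"
    then interpret block_system F m a c c' d' d b using near by simp
    show "inj_on (fiber_map F i) {0..1}" if "i \<in> {1..4}" for i by (rule injective[OF that])
    show "\<forall>\<theta> x. disjunctive \<theta> \<and> x \<in> {0..1} \<longrightarrow> closure (coding_graph F) = omega_limit F (\<theta>, x)"
      using closure_coding_graph_eq_omega_limit by blast
    show "\<exists>\<Gamma>. dense_in_\<Sigma>4 \<Gamma> \<and> (\<forall>\<theta>\<in>\<Gamma>. \<exists>A. union_of_intervals m A \<and>
           ({\<theta>} \<times> {0..1}) \<inter> closure (coding_graph F) = {\<theta>} \<times> A)"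
      using dense_past_eventually_one fibre_closure_coding_graph by blast
  qed
qed

end
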